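(* Let $d>3$ and let $S\subset\mathbf{R}^d$ be a Gutkin billiard table corresponding to an angle $\delta\in(0,\pi/2)$. (1) If there is no odd integer $n>3$ with $\tan(n\delta)=n\tan\delta$, then $S$ is a round sphere. (2) If $\tan(n\delta)=n\tan\delta$ for some odd integer $n>3$, then $S$ bounds a body of constant width; moreover, every geodesic curve on $S$ which is tangent to a principal direction of $S$ at some point lies in a 2-plane $\sigma$, and the closed convex curve $S\cap\sigma$ is a planar Gutkin billiard table (in the plane $\sigma$) for the same angle $\delta$.
   Context: A Gutkin billiard table in $\mathbf{R}^d$ ($d\ge 2$) is a smooth closed hypersurface $S$ bounding a compact convex domain, with all principal curvatures (for $d=2$: the curvature) strictly positive everywhere, for which there exists $\delta\in(0,\pi/2)$ such that for every pair of distinct points $p,q\in S$: if the angle between the vector $\overrightarrow{pq}$ and the tangent hyperplane $T_pS$ equals $\delta$, then the angle between $\overrightarrow{pq}$ and the tangent hyperplane $T_qS$ also equals $\delta$. A principal direction at $p$ is an eigenvector of the shape operator of $S$ at $p$. *)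

theory Defs
  imports "HOL-Analysis.Analysis"
begin

fun Ck :: "nat \<Rightarrow> ('a::euclidean_space \<Rightarrow> real) \<Rightarrow> bool" where
  "Ck 0 f = continuous_on UNIV f"
| "Ck (Suc k) f = ((\<forall>x. f differentiable (at x)) \<and>
      (\<forall>v. Ck k (\<lambda>x. frechet_derivative f (at x) v)))"

definition smooth_fun :: "('a::euclidean_space \<Rightarrow> real) \<Rightarrow> bool" where
  "smooth_fun f \<longleftrightarrow> (\<forall>k. Ck k f)"

definition grad :: "('a::euclidean_space \<Rightarrow> real) \<Rightarrow> 'a \<Rightarrow> 'a" where
  "grad F x = (\<Sum>b\<in>Basis. frechet_derivative F (at x) b *\<^sub>R b)"

definition surf :: "('a::euclidean_space \<Rightarrow> real) \<Rightarrow> 'a set" where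
  "surf F = {x. F x = 0}"

definition body :: "('a::euclidean_space \<Rightarrow> real) \<Rightarrow> 'a set" where
  "body F = {x. F x \<le> 0}"

text \<open>F is a global smooth defining function of a smooth closed hypersurface
  bounding a compact convex domain (namely body F), with F < 0 inside.\<close>
definition convex_defining_function :: "('a::euclidean_space \<Rightarrow> real) \<Rightarrow> bool" where
  "convex_defining_function F \<longleftrightarrow>
     smooth_fun F \<and> surf F \<noteq> {} \<and> (\<forall>x\<in>surf F. grad F x \<noteq> 0) \<and>
     compact (body F) \<and> convex (body F)"

definition unit_normal :: "('a::euclidean_space \<Rightarrow> real) \<Rightarrow> 'a \<Rightarrow> 'a" where
  "unit_normal F x = grad F x /\<^sub>R norm (grad F x)"

definition tangent_space :: "('a::euclidean_space \<Rightarrow> real) \<Rightarrow> 'a \<Rightarrow> 'a set" where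
  "tangent_space F p = {v. grad F p \<bullet> v = 0}"

definition shape_operator :: "('a::euclidean_space \<Rightarrow> real) \<Rightarrow> 'a \<Rightarrow> 'a \<Rightarrow> 'a" where
  "shape_operator F p = frechet_derivative (unit_normal F) (at p)"

definition principal_pair :: "('a::euclidean_space \<Rightarrow> real) \<Rightarrow> 'a \<Rightarrow> real \<Rightarrow> 'a \<Rightarrow> bool" where
  "principal_pair F p \<kappa> v \<longleftrightarrow>
     v \<in> tangent_space F p \<and> v \<noteq> 0 \<and> shape_operator F p v = \<kappa> *\<^sub>R v"

definition principal_direction :: "('a::euclidean_space \<Rightarrow> real) \<Rightarrow> 'a \<Rightarrow> 'a \<Rightarrow> bool" where
  "principal_direction F p v \<longleftrightarrow> (\<exists>\<kappa>. principal_pair F p \<kappa> v)"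

definition hyperplane_angle :: "'a::euclidean_space \<Rightarrow> 'a \<Rightarrow> real" where
  "hyperplane_angle w n = arcsin (\<bar>w \<bullet> n\<bar> / (norm w * norm n))"

definition gutkin_table :: "('a::euclidean_space \<Rightarrow> real) \<Rightarrow> real \<Rightarrow> bool" where
  "gutkin_table F \<delta> \<longleftrightarrow>
     DIM('a) \<ge> 2 \<and> 0 < \<delta> \<and> \<delta> < pi / 2 \<and>
     convex_defining_function F \<and>
     (\<forall>p\<in>surf F. \<forall>\<kappa> v. principal_pair F p \<kappa> v \<longrightarrow> \<kappa> > 0) \<and>
     (\<forall>p\<in>surf F. \<forall>q\<in>surf F. p \<noteq> q \<longrightarrow>
        hyperplane_angle (q - p) (grad F p) = \<delta> \<longrightarrow>
        hyperplane_angle (q - p) (grad F q) = \<delta>)"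

definition width :: "'a::euclidean_space set \<Rightarrow> 'a \<Rightarrow> real" where
  "width K u = (SUP x\<in>K. x \<bullet> u) - (INF x\<in>K. x \<bullet> u)"

definition constant_width :: "'a::euclidean_space set \<Rightarrow> bool" where
  "constant_width K \<longleftrightarrow> (\<exists>w. \<forall>u. norm u = 1 \<longrightarrow> width K u = w)"

definition geodesic :: "('a::euclidean_space \<Rightarrow> real) \<Rightarrow> real set \<Rightarrow> (real \<Rightarrow> 'a) \<Rightarrow> bool" where
  "geodesic F I \<gamma> \<longleftrightarrow>
     open I \<and> is_interval I \<and> I \<noteq> {} \<and>
     (\<exists>\<gamma>' \<gamma>''. \<forall>t\<in>I.
        \<gamma> t \<in> surf F \<and>
        (\<gamma> has_vector_derivative \<gamma>' t) (at t) \<and>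
        (\<gamma>' has_vector_derivative \<gamma>'' t) (at t) \<and>
        \<gamma>' t \<noteq> 0 \<and>
        (\<exists>c. \<gamma>'' t = c *\<^sub>R grad F (\<gamma> t)))"

definition plane_chart :: "'a::euclidean_space \<Rightarrow> 'a \<Rightarrow> 'a \<Rightarrow> real \<times> real \<Rightarrow> 'a" where
  "plane_chart a u w z = a + fst z *\<^sub>R u + snd z *\<^sub>R w"

definition orthonormal2 :: "'a::euclidean_space \<Rightarrow> 'a \<Rightarrow> bool" where
  "orthonormal2 u w \<longleftrightarrow> norm u = 1 \<and> norm w = 1 \<and> u \<bullet> w = 0"

end

theory Submission
  imports Defs
begin

text \<open>
  A Gutkin table in dimension greater than three is a round sphere, for every \<open>\<delta>\<close>; both parts are read
  off from this. Write \<open>s = sin \<delta>\<close>, \<open>c = cos \<delta>\<close>, let \<open>N\<close> be the outer normal and \<open>A\<close> the shape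
  operator. For a unit tangent vector \<open>v\<close> at \<open>p\<close> let \<open>L(p,v)\<close> be the length of the chord leaving \<open>p\<close>
  in direction \<open>\<omega> = c v - s N(p)\<close>. The pairs \<open>(p,q)\<close> with angle \<open>\<delta>\<close> at \<open>p\<close> and those with angle \<open>\<delta>\<close>
  at \<open>q\<close> form the same hypersurface of pairs, so the two angle conditions have proportional differentials.
  The factor \<open>r\<close> of proportionality satisfies
  \<open>r\<^sup>2 = L\<^sup>2 |Av|\<^sup>2 - 2 s L k + s\<^sup>2 + (c/s)\<^sup>2 (L k - s)\<^sup>2\<close> with \<open>k = Av \<bullet> v\<close>, never vanishes, and gives
  \<open>\<partial>\<^sub>w L = - (c\<^sup>2/s) L\<^sup>2 (Av \<bullet> w) / r\<close> when \<open>v\<close> is rotated towards \<open>w\<close>, and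
  \<open>L' = c (r - 1)\<close> along the geodesic with velocity \<open>v\<close>.

  At a fixed \<open>p\<close>, both \<open>L(p,v)\<close> and \<open>L(p,-v)\<close> solve the first equation along a great circle of directions;
  their difference is odd, hence vanishes somewhere, hence everywhere. So \<open>L\<close> and \<open>r\<close> are even in \<open>v\<close>,
  whereas the geodesic derivative of an even function is odd. Therefore \<open>r = 1\<close>; the two equations for \<open>L\<close> then
  force \<open>|Av|\<^sup>2 = \<kappa> (Av \<bullet> v)\<close>, i.e. every point is umbilic, and \<open>L = 2 s / \<kappa>\<close> is constant.
\<close>

section \<open>Second derivatives and implicit roots\<close>

text \<open>The mean value theorem is used twice: along \<open>u\<close> for the difference over
  \<open>v\<close>, then along \<open>v\<close> for the gradient. The left side is symmetric in
  \<open>u\<close> and \<open>v\<close>, the right side is not; comparing both orders is the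
  purpose.\<close>

lemma mixed_difference_mean_value:
  fixes f :: "'a::euclidean_space \<Rightarrow> real" and G :: "'a \<Rightarrow> 'a"
  assumes f: "\<And>x. (f has_derivative (\<lambda>h. G x \<bullet> h)) (at x)"
    and G: "\<And>x. (G has_derivative H x) (at x)" and t: "t > 0"
  shows "\<exists>y. norm (y - x) \<le> t * (norm u + norm v) \<and>
    f (x + t *\<^sub>R u + t *\<^sub>R v) - f (x + t *\<^sub>R u) - f (x + t *\<^sub>R v) + f x = t\<^sup>2 * (H y v \<bullet> u)"
proof -
  define \<phi> where "\<phi> a = f (x + a *\<^sub>R u + t *\<^sub>R v) - f (x + a *\<^sub>R u)" for a
  have d\<phi>: "(\<phi> has_real_derivative (G (x + a *\<^sub>R u + t *\<^sub>R v) - G (x + a *\<^sub>R u)) \<bullet> u) (at a)" for a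
  proof -
    have "((\<lambda>a. f (x + a *\<^sub>R u + t *\<^sub>R v)) has_derivative (\<lambda>h. G (x + a *\<^sub>R u + t *\<^sub>R v) \<bullet> (h *\<^sub>R u))) (at a)"
      by (rule has_derivative_compose[OF _ f]) (auto intro!: derivative_eq_intros)
    moreover have "((\<lambda>a. f (x + a *\<^sub>R u)) has_derivative (\<lambda>h. G (x + a *\<^sub>R u) \<bullet> (h *\<^sub>R u))) (at a)"
      by (rule has_derivative_compose[OF _ f]) (auto intro!: derivative_eq_intros)
    ultimately show ?thesis
      unfolding \<phi>_def has_field_derivative_def
      by (auto intro!: derivative_eq_intros simp: algebra_simps)
  qed
  obtain \<xi> where \<xi>: "0 < \<xi>" "\<xi> < t"
    and 1: "\<phi> t - \<phi> 0 = (t - 0) * ((G (x + \<xi> *\<^sub>R u + t *\<^sub>R v) - G (x + \<xi> *\<^sub>R u)) \<bullet> u)"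
    using MVT2[OF t d\<phi>] by blast
  define \<psi> where "\<psi> b = G (x + \<xi> *\<^sub>R u + b *\<^sub>R v) \<bullet> u" for b
  have d\<psi>: "(\<psi> has_real_derivative H (x + \<xi> *\<^sub>R u + b *\<^sub>R v) v \<bullet> u) (at b)" for b
  proof -
    interpret H: bounded_linear "H (x + \<xi> *\<^sub>R u + b *\<^sub>R v)"
      using G by (rule has_derivative_bounded_linear)
    have "((\<lambda>b. G (x + \<xi> *\<^sub>R u + b *\<^sub>R v)) has_derivative (\<lambda>h. H (x + \<xi> *\<^sub>R u + b *\<^sub>R v) (h *\<^sub>R v))) (at b)"
      by (rule has_derivative_compose[OF _ G]) (auto intro!: derivative_eq_intros)
    then have "(\<psi> has_derivative (\<lambda>h. H (x + \<xi> *\<^sub>R u + b *\<^sub>R v) (h *\<^sub>R v) \<bullet> u)) (at b)"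
      unfolding \<psi>_def by (auto intro!: derivative_eq_intros)
    then show ?thesis
      by (simp add: has_field_derivative_def H.scaleR mult_commute_abs)
  qed
  obtain \<eta> where \<eta>: "0 < \<eta>" "\<eta> < t"
    and 2: "\<psi> t - \<psi> 0 = (t - 0) * (H (x + \<xi> *\<^sub>R u + \<eta> *\<^sub>R v) v \<bullet> u)"
    using MVT2[OF t d\<psi>] by blast
  have "norm (\<xi> *\<^sub>R u + \<eta> *\<^sub>R v) \<le> \<xi> * norm u + \<eta> * norm v"
    using norm_triangle_ineq[of "\<xi> *\<^sub>R u" "\<eta> *\<^sub>R v"] \<xi> \<eta> by simp
  also have "\<dots> \<le> t * (norm u + norm v)"
    using \<xi> \<eta> by (simp add: distrib_left add_mono mult_right_mono)
  finally have "norm ((x + \<xi> *\<^sub>R u + \<eta> *\<^sub>R v) - x) \<le> t * (norm u + norm v)"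
    by (simp add: add.assoc)
  moreover have "f (x + t *\<^sub>R u + t *\<^sub>R v) - f (x + t *\<^sub>R u) - f (x + t *\<^sub>R v) + f x
      = t\<^sup>2 * (H (x + \<xi> *\<^sub>R u + \<eta> *\<^sub>R v) v \<bullet> u)"
    using 1 2 unfolding \<phi>_def \<psi>_def by (simp add: inner_diff_left power2_eq_square)
  ultimately show ?thesis by blast
qed

text \<open>Schwarz's theorem. The same mixed difference read in both orders gives
  \<open>H y v \<bullet> u = H z u \<bullet> v\<close> at two points near \<open>x\<close>, and
  continuity of the entries of \<open>H\<close> carries the equality to \<open>x\<close>.\<close>

lemma symmetric_second_derivative:
  fixes f :: "'a::euclidean_space \<Rightarrow> real" and G :: "'a \<Rightarrow> 'a"
  assumes f: "\<And>x. (f has_derivative (\<lambda>h. G x \<bullet> h)) (at x)"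
    and G: "\<And>x. (G has_derivative H x) (at x)"
    and H: "\<And>u v. continuous_on UNIV (\<lambda>x. H x u \<bullet> v)"
  shows "H x u \<bullet> v = H x v \<bullet> u"
proof -
  have "\<bar>H x u \<bullet> v - H x v \<bullet> u\<bar> \<le> \<epsilon>" if "\<epsilon> > 0" for \<epsilon>
  proof -
    have e2: "\<epsilon>/2 > 0" using that by simp
    have "continuous (at x) (\<lambda>y. H y u \<bullet> v)" "continuous (at x) (\<lambda>y. H y v \<bullet> u)"
      using H continuous_on_eq_continuous_at by blast+
    then obtain d1 d2 where d: "d1 > 0" "d2 > 0"
      and d1: "\<And>y. norm (y - x) < d1 \<Longrightarrow> \<bar>H y u \<bullet> v - H x u \<bullet> v\<bar> < \<epsilon>/2"
      and d2: "\<And>y. norm (y - x) < d2 \<Longrightarrow> \<bar>H y v \<bullet> u - H x v \<bullet> u\<bar> < \<epsilon>/2"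
      unfolding continuous_at_eps_delta dist_norm by (metis e2 real_norm_def)
    define K where "K = norm u + norm v + 1"
    define t where "t = min d1 d2 / (2 * K)"
    have K: "K > 0" unfolding K_def by (simp add: add_nonneg_pos)
    have t: "t > 0" using d K by (simp add: t_def)
    have tK: "t * (norm u + norm v) < min d1 d2"
    proof -
      have "t * (norm u + norm v) \<le> t * K" using t by (simp add: K_def)
      also have "\<dots> = min d1 d2 / 2" using K by (simp add: t_def)
      finally show ?thesis using d by auto
    qed
    obtain y where y: "norm (y - x) \<le> t * (norm u + norm v)"
      "f (x + t *\<^sub>R u + t *\<^sub>R v) - f (x + t *\<^sub>R u) - f (x + t *\<^sub>R v) + f x = t\<^sup>2 * (H y v \<bullet> u)"
      using mixed_difference_mean_value[OF f G t] by blast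
    obtain z where z: "norm (z - x) \<le> t * (norm v + norm u)"
      "f (x + t *\<^sub>R v + t *\<^sub>R u) - f (x + t *\<^sub>R v) - f (x + t *\<^sub>R u) + f x = t\<^sup>2 * (H z u \<bullet> v)"
      using mixed_difference_mean_value[OF f G t] by blast
    have "t\<^sup>2 * (H y v \<bullet> u) = t\<^sup>2 * (H z u \<bullet> v)"
      using y(2) z(2) by (simp add: algebra_simps)
    then have "H y v \<bullet> u = H z u \<bullet> v" using t by simp
    moreover have "\<bar>H z u \<bullet> v - H x u \<bullet> v\<bar> < \<epsilon>/2" using d1 z(1) tK by (simp add: add.commute)
    moreover have "\<bar>H y v \<bullet> u - H x v \<bullet> u\<bar> < \<epsilon>/2" using d2 y(1) tK by simp
    ultimately show ?thesis by linarith
  qed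
  then have "\<bar>H x u \<bullet> v - H x v \<bullet> u\<bar> \<le> 0" by (rule field_le_epsilon) simp
  then show ?thesis by simp
qed

lemma vector_difference_quotient:
  assumes "(x has_vector_derivative x') (at t0)"
  shows "((\<lambda>t. (x t - x t0) /\<^sub>R (t - t0)) \<longlongrightarrow> x') (at t0)"
proof -
  have "((\<lambda>t. (x t - x t0 - (t - t0) *\<^sub>R x') /\<^sub>R norm (t - t0)) \<longlongrightarrow> 0) (at t0)"
    using assms unfolding has_vector_derivative_def has_derivative_at_within by auto
  then have "((\<lambda>t. norm ((x t - x t0 - (t - t0) *\<^sub>R x') /\<^sub>R norm (t - t0))) \<longlongrightarrow> 0) (at t0)"
    by (rule tendsto_norm_zero)
  moreover have "\<forall>\<^sub>F t in at t0. norm ((x t - x t0 - (t - t0) *\<^sub>R x') /\<^sub>R norm (t - t0))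
      = norm ((x t - x t0) /\<^sub>R (t - t0) - x')"
    unfolding eventually_at_filter
  proof (rule always_eventually, intro allI impI)
    fix t assume "t \<noteq> t0"
    then have "(x t - x t0) /\<^sub>R (t - t0) - x' = (x t - x t0 - (t - t0) *\<^sub>R x') /\<^sub>R (t - t0)"
      by (simp add: scaleR_diff_right)
    then show "norm ((x t - x t0 - (t - t0) *\<^sub>R x') /\<^sub>R norm (t - t0)) = norm ((x t - x t0) /\<^sub>R (t - t0) - x')"
      by simp
  qed
  ultimately have "((\<lambda>t. norm ((x t - x t0) /\<^sub>R (t - t0) - x')) \<longlongrightarrow> 0) (at t0)"
    by (rule Lim_transform_eventually)
  then have "((\<lambda>t. (x t - x t0) /\<^sub>R (t - t0) - x') \<longlongrightarrow> 0) (at t0)"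
    by (rule tendsto_norm_zero_cancel)
  then show ?thesis by (rule Lim_null[THEN iffD2])
qed

text \<open>Implicit differentiation of a continuous root along a moving line. The difference
  quotient of \<open>\<tau>\<close> is solved for exactly by means of a slope vector of
  \<open>F\<close>, and only then is the limit taken.\<close>

lemma implicit_root_derivative:
  fixes F :: "'a::euclidean_space \<Rightarrow> real" and x d :: "real \<Rightarrow> 'a" and \<tau> :: "real \<Rightarrow> real"
  assumes F: "(F has_derivative (\<lambda>h. g \<bullet> h)) (at (x t0 + \<tau> t0 *\<^sub>R d t0))"
    and x: "(x has_vector_derivative x') (at t0)"
    and d: "(d has_vector_derivative d') (at t0)"
    and \<tau>: "isCont \<tau> t0"
    and root: "\<And>t. F (x t + \<tau> t *\<^sub>R d t) = 0"
    and nz: "g \<bullet> d t0 \<noteq> 0"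
  shows "(\<tau> has_real_derivative - (g \<bullet> (x' + \<tau> t0 *\<^sub>R d')) / (g \<bullet> d t0)) (at t0)"
proof -
  define y where "y t = x t + \<tau> t *\<^sub>R d t" for t
  \<comment> \<open>Caratheodory's form of differentiability: a slope vector, continuous at the base point.\<close>
  define s where "s z = g + ((F z - F (y t0) - g \<bullet> (z - y t0)) / (norm (z - y t0))\<^sup>2) *\<^sub>R (z - y t0)" for z
  have s: "F z - F (y t0) = s z \<bullet> (z - y t0)" for z
    by (cases "z = y t0") (auto simp: s_def inner_add_left power2_norm_eq_inner)
  have "((\<lambda>z. s z - g) \<longlongrightarrow> 0) (at (y t0))"
  proof (rule tendsto_norm_zero_cancel)
    have "((\<lambda>z. norm (F z - F (y t0) - g \<bullet> (z - y t0)) / norm (z - y t0)) \<longlongrightarrow> 0) (at (y t0))"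
      using F unfolding y_def[symmetric] has_derivative_iff_norm by blast
    then show "((\<lambda>z. norm (s z - g)) \<longlongrightarrow> 0) (at (y t0))"
      by (rule Lim_transform_eventually) (auto simp: s_def power2_eq_square eventually_at_filter)
  qed
  then have "isCont s (y t0)"
    unfolding isCont_def by (subst (asm) Lim_null[symmetric]) (simp add: s_def)
  moreover have xc: "isCont x t0" and dc: "isCont d t0"
    using x d has_vector_derivative_continuous by blast+
  then have "isCont y t0" unfolding y_def using \<tau> by (intro continuous_intros)
  ultimately have sy: "isCont (\<lambda>t. s (y t)) t0" by (simp add: continuous_at_compose[unfolded o_def] isCont_o2)
  have sy': "((\<lambda>t. s (y t)) \<longlongrightarrow> g) (at t0)"
    using sy by (simp add: isCont_def s_def)
  have x1: "((\<lambda>t. (x t - x t0) /\<^sub>R (t - t0)) \<longlongrightarrow> x') (at t0)"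
    using x by (rule vector_difference_quotient)
  have d1: "((\<lambda>t. (d t - d t0) /\<^sub>R (t - t0)) \<longlongrightarrow> d') (at t0)"
    using d by (rule vector_difference_quotient)
  have \<tau>': "(\<tau> \<longlongrightarrow> \<tau> t0) (at t0)" using \<tau> by (simp add: isCont_def)
  have lim: "((\<lambda>t. - (s (y t) \<bullet> ((x t - x t0) /\<^sub>R (t - t0) + \<tau> t *\<^sub>R ((d t - d t0) /\<^sub>R (t - t0)))) / (s (y t) \<bullet> d t0))
     \<longlongrightarrow> - (g \<bullet> (x' + \<tau> t0 *\<^sub>R d')) / (g \<bullet> d t0)) (at t0)"
    by (intro tendsto_intros x1 d1 \<tau>' sy' nz)
  have "((\<lambda>t. s (y t) \<bullet> d t0) \<longlongrightarrow> g \<bullet> d t0) (at t0)" by (intro tendsto_intros sy')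
  then have "\<forall>\<^sub>F t in at t0. s (y t) \<bullet> d t0 \<noteq> 0"
    using nz by (rule tendsto_imp_eventually_ne)
  moreover have "\<forall>\<^sub>F t in at t0. t \<noteq> t0" by (simp add: eventually_at_filter)
  ultimately have "\<forall>\<^sub>F t in at t0. - (s (y t) \<bullet> ((x t - x t0) /\<^sub>R (t - t0) + \<tau> t *\<^sub>R ((d t - d t0) /\<^sub>R (t - t0)))) / (s (y t) \<bullet> d t0)
     = (\<tau> t - \<tau> t0) / (t - t0)"
  proof eventually_elim
    case (elim t)
    have "y t - y t0 = (x t - x t0) + \<tau> t *\<^sub>R (d t - d t0) + (\<tau> t - \<tau> t0) *\<^sub>R d t0"
      by (simp add: y_def algebra_simps)
    \<comment> \<open>Both points are zeros of \<open>F\<close>, so the slope is exactly orthogonal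
      to the displacement, not just to first order.\<close>
    moreover have "s (y t) \<bullet> (y t - y t0) = 0" using s[of "y t"] root by (simp add: y_def)
    ultimately have "s (y t) \<bullet> ((x t - x t0) + \<tau> t *\<^sub>R (d t - d t0)) = - (\<tau> t - \<tau> t0) * (s (y t) \<bullet> d t0)"
      by (simp add: inner_add_right left_diff_distrib)
    moreover have "(x t - x t0) /\<^sub>R (t - t0) + \<tau> t *\<^sub>R ((d t - d t0) /\<^sub>R (t - t0))
       = ((x t - x t0) + \<tau> t *\<^sub>R (d t - d t0)) /\<^sub>R (t - t0)" by (simp add: algebra_simps)
    ultimately have eq: "s (y t) \<bullet> ((x t - x t0) /\<^sub>R (t - t0) + \<tau> t *\<^sub>R ((d t - d t0) /\<^sub>R (t - t0)))
        = - (\<tau> t - \<tau> t0) * (s (y t) \<bullet> d t0) / (t - t0)"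
      by (simp only: inner_scaleR_right) (simp add: field_class.field_divide_inverse)
    show ?case unfolding eq using elim by (simp add: field_simps)
  qed
  with lim have "((\<lambda>t. (\<tau> t - \<tau> t0) / (t - t0)) \<longlongrightarrow> - (g \<bullet> (x' + \<tau> t0 *\<^sub>R d')) / (g \<bullet> d t0)) (at t0)"
    by (rule Lim_transform_eventually)
  then show ?thesis by (simp add: has_field_derivative_iff)
qed

text \<open>Integrating factor: with \<open>g\<close> an antiderivative of \<open>h\<close> between
  \<open>t\<close> and \<open>t0\<close>, the product \<open>D x * exp (- g x)\<close> is constant
  there.\<close>

lemma linear_ode_zero:
  fixes D h :: "real \<Rightarrow> real"
  assumes D: "\<And>t. (D has_real_derivative h t * D t) (at t)"
    and h: "continuous_on UNIV h" and t0: "D t0 = 0"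
  shows "D t = 0"
proof -
  define a b where "a = min t t0" and "b = max t t0"
  have "continuous_on {a..b} h" using h continuous_on_subset by blast
  then obtain g where g: "\<And>x. x \<in> {a..b} \<Longrightarrow> (g has_vector_derivative h x) (at x within {a..b})"
    using antiderivative_continuous by blast
  have "((\<lambda>x. D x * exp (- g x)) has_field_derivative 0) (at x within {a..b})" if "x \<in> {a..b}" for x
    using g[OF that] has_field_derivative_at_within[OF D]
    by (auto intro!: derivative_eq_intros simp: has_real_derivative_iff_has_vector_derivative[symmetric])
  then obtain C where "\<And>x. x \<in> {a..b} \<Longrightarrow> D x * exp (- g x) = C"
    using has_field_derivative_zero_constant[of "{a..b}" "\<lambda>x. D x * exp (- g x)"] by auto
  moreover have "t \<in> {a..b}" "t0 \<in> {a..b}" by (auto simp: a_def b_def)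
  ultimately have "D t * exp (- g t) = D t0 * exp (- g t0)" by metis
  then show ?thesis using t0 by simp
qed

section \<open>Gradient and Hessian of a smooth function\<close>

lemma smooth_gradient:
  fixes F :: "'a::euclidean_space \<Rightarrow> real"
  assumes "smooth_fun F"
  shows "(F has_derivative (\<lambda>h. grad F x \<bullet> h)) (at x)"
proof -
  have "Ck (Suc 0) F" using assms unfolding smooth_fun_def by blast
  then have d: "(F has_derivative frechet_derivative F (at x)) (at x)"
    by (simp add: frechet_derivative_works)
  then interpret bounded_linear "frechet_derivative F (at x)" by (rule has_derivative_bounded_linear)
  have "frechet_derivative F (at x) h = grad F x \<bullet> h" for h
  proof -
    have "frechet_derivative F (at x) h = frechet_derivative F (at x) (\<Sum>b\<in>Basis. (h \<bullet> b) *\<^sub>R b)"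
      by (simp add: euclidean_representation)
    also have "\<dots> = grad F x \<bullet> h"
      by (simp add: sum scaleR grad_def inner_sum_left inner_commute[of h] mult.commute)
    finally show ?thesis .
  qed
  then have "frechet_derivative F (at x) = (\<lambda>h. grad F x \<bullet> h)" by blast
  then show ?thesis using d by simp
qed

text \<open>\<open>Ck\<close> speaks only of scalar directional derivatives, so the derivative of
  the gradient is assembled from its components. Two levels of \<open>Ck\<close> make its entries
  continuous, and Schwarz's theorem applies.\<close>

lemma smooth_hessian:
  fixes F :: "'a::euclidean_space \<Rightarrow> real"
  assumes "smooth_fun F"
  shows "(grad F has_derivative frechet_derivative (grad F) (at x)) (at x)"
    and "frechet_derivative (grad F) (at x) u \<bullet> v = frechet_derivative (grad F) (at x) v \<bullet> u"
proof -
  have "Ck (Suc (Suc 0)) F" using assms unfolding smooth_fun_def by blast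
  then have C1: "Ck (Suc 0) (\<lambda>x. grad F x \<bullet> v)" for v
    using frechet_derivative_at[OF smooth_gradient[OF assms]] by (metis (no_types, lifting) Ck.simps(2) ext)
  define D where "D x i = frechet_derivative (\<lambda>x. grad F x \<bullet> i) (at x)" for x i
  have D: "((\<lambda>x. grad F x \<bullet> i) has_derivative D x i) (at x)" for x i
    using C1[of i] by (simp add: D_def frechet_derivative_works)
  have "(grad F has_derivative (\<lambda>h. \<Sum>i\<in>Basis. D x i h *\<^sub>R i)) (at x)" for x
  proof (rule has_derivative_componentwise_within[THEN iffD2], rule ballI)
    fix i :: 'a assume "i \<in> Basis"
    then have "(\<lambda>h. (\<Sum>j\<in>Basis. D x j h *\<^sub>R j) \<bullet> i) = D x i" by simp
    then show "((\<lambda>x. grad F x \<bullet> i) has_derivative (\<lambda>h. (\<Sum>j\<in>Basis. D x j h *\<^sub>R j) \<bullet> i)) (at x)"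
      using D by simp
  qed
  then show H: "(grad F has_derivative frechet_derivative (grad F) (at x)) (at x)" for x
    unfolding frechet_derivative_works[symmetric] by (rule differentiableI)
  have "continuous_on UNIV (\<lambda>x. frechet_derivative (grad F) (at x) u \<bullet> v)" for u v
  proof -
    have "((\<lambda>x. grad F x \<bullet> v) has_derivative (\<lambda>h. frechet_derivative (grad F) (at x) h \<bullet> v)) (at x)" for x
      using H by (auto intro!: derivative_eq_intros)
    then have "(\<lambda>h. frechet_derivative (grad F) (at x) h \<bullet> v) = frechet_derivative (\<lambda>x. grad F x \<bullet> v) (at x)" for x
      by (rule frechet_derivative_at)
    then have "frechet_derivative (\<lambda>x. grad F x \<bullet> v) (at x) u = frechet_derivative (grad F) (at x) u \<bullet> v" for x
      by metis
    moreover have "continuous_on UNIV (\<lambda>x. frechet_derivative (\<lambda>x. grad F x \<bullet> v) (at x) u)"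
      using C1[of v] by simp
    ultimately show ?thesis by simp
  qed
  then show "frechet_derivative (grad F) (at x) u \<bullet> v = frechet_derivative (grad F) (at x) v \<bullet> u"
    by (rule symmetric_second_derivative[OF smooth_gradient[OF assms] H])
qed

section \<open>Convex hypersurfaces and exit times\<close>

locale convex_table =
  fixes F :: "'a::euclidean_space \<Rightarrow> real"
  assumes defining: "convex_defining_function F"
begin

abbreviation N :: "'a \<Rightarrow> 'a" where "N \<equiv> unit_normal F"
abbreviation A :: "'a \<Rightarrow> 'a \<Rightarrow> 'a" where "A \<equiv> shape_operator F"

lemma smooth: "smooth_fun F"
  and grad_nonzero: "p \<in> surf F \<Longrightarrow> grad F p \<noteq> 0"
  and compact_body: "compact (body F)"
  and convex_body: "convex (body F)"
  and surf_nonempty: "surf F \<noteq> {}"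
  using defining unfolding convex_defining_function_def by auto

lemmas F_derivative = smooth_gradient[OF smooth]

lemma isCont_F: "isCont F x"
  using F_derivative has_derivative_continuous by blast

lemma continuous_F: "continuous_on S F"
  using isCont_F continuous_at_imp_continuous_on by blast

lemma F_line_derivative:
  "((\<lambda>t. F (x + t *\<^sub>R d)) has_real_derivative grad F (x + t *\<^sub>R d) \<bullet> d) (at t)"
proof -
  have "((\<lambda>t. F (x + t *\<^sub>R d)) has_derivative (\<lambda>h. grad F (x + t *\<^sub>R d) \<bullet> (h *\<^sub>R d))) (at t)"
    by (rule has_derivative_compose[OF _ F_derivative]) (auto intro!: derivative_eq_intros)
  then show ?thesis by (simp add: has_field_derivative_def mult_commute_abs)
qed

lemma surf_body: "p \<in> surf F \<Longrightarrow> p \<in> body F"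
  by (simp add: surf_def body_def)

lemma negative_interior: "F x < 0 \<Longrightarrow> x \<in> interior (body F)"
proof -
  assume "F x < 0"
  have "open {y. F y < 0}"
    using continuous_F by (intro open_Collect_less) auto
  moreover have "{y. F y < 0} \<subseteq> body F" by (auto simp: body_def)
  ultimately show ?thesis using \<open>F x < 0\<close> interior_maximal by blast
qed

text \<open>An interior zero would be a local maximum of \<open>F\<close>, forcing the gradient to
  vanish there.\<close>

lemma surf_not_interior: "p \<in> surf F \<Longrightarrow> p \<notin> interior (body F)"
proof
  assume p: "p \<in> surf F" "p \<in> interior (body F)"
  then obtain e where e: "e > 0" "ball p e \<subseteq> body F"
    by (auto simp: mem_interior)
  have "(\<lambda>h. grad F p \<bullet> h) = (\<lambda>h. 0)"
    by (rule differential_zero_maxmin[of p "ball p e" F]) (use F_derivative e p in \<open>auto simp: body_def surf_def\<close>)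
  then have "grad F p \<bullet> grad F p = 0" by meson
  then show False using grad_nonzero p by simp
qed

section \<open>Unit normal field and shape operator\<close>

lemma norm_normal: "p \<in> surf F \<Longrightarrow> norm (N p) = 1"
  by (simp add: unit_normal_def grad_nonzero)

lemma normal_inner_normal: "p \<in> surf F \<Longrightarrow> N p \<bullet> N p = 1"
  by (metis norm_normal norm_eq_1)

lemma grad_eq: "p \<in> surf F \<Longrightarrow> grad F p = norm (grad F p) *\<^sub>R N p"
  by (simp add: unit_normal_def grad_nonzero)

lemma normal_inner: "p \<in> surf F \<Longrightarrow> grad F p \<bullet> u = norm (grad F p) * (N p \<bullet> u)"
  by (metis grad_eq inner_scaleR_left)

lemma continuous_grad: "isCont (grad F) x"
  using smooth_hessian(1)[OF smooth] has_derivative_continuous by blast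

lemma isCont_normal: "p \<in> surf F \<Longrightarrow> isCont N p"
  unfolding unit_normal_def by (intro continuous_intros continuous_grad) (simp add: grad_nonzero)

lemma normal_derivative:
  assumes p: "p \<in> surf F"
  shows "(N has_derivative A p) (at p)"
proof -
  have "(norm has_derivative (\<lambda>h. h \<bullet> sgn (grad F p))) (at (grad F p))"
    using grad_nonzero[OF p] has_derivative_norm by blast
  then have "(\<lambda>x. norm (grad F x)) differentiable (at p)"
    using has_derivative_compose[OF smooth_hessian(1)[OF smooth]] differentiableI by blast
  then have "N differentiable (at p)"
    unfolding unit_normal_def using smooth_hessian(1)[OF smooth] grad_nonzero[OF p]
    by (intro differentiable_scaleR differentiable_inverse) (auto simp: differentiable_def)
  then show ?thesis by (simp add: shape_operator_def frechet_derivative_works)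
qed

lemma bounded_linear_shape: "p \<in> surf F \<Longrightarrow> bounded_linear (A p)"
  using normal_derivative has_derivative_bounded_linear by blast

lemma linear_shape: "p \<in> surf F \<Longrightarrow> linear (A p)"
  using bounded_linear_shape bounded_linear.linear by blast

lemma grad_nonzero_nearby:
  assumes p: "p \<in> surf F"
  shows "\<forall>\<^sub>F x in nhds p. grad F x \<noteq> 0"
  using continuous_grad[of p] grad_nonzero[OF p]
  by (metis isCont_def tendsto_imp_eventually_ne tendsto_at_iff_tendsto_nhds)

text \<open>The field \<open>N\<close> is normalised off the hypersurface too, so
  \<open>N x \<bullet> N x = 1\<close> on a full neighbourhood of \<open>p\<close> and can be
  differentiated in every direction.\<close>

lemma shape_tangent:
  assumes p: "p \<in> surf F"
  shows "A p u \<bullet> N p = 0"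
proof -
  have "((\<lambda>x. N x \<bullet> N x) has_derivative (\<lambda>h. N p \<bullet> A p h + A p h \<bullet> N p)) (at p)"
    by (intro derivative_intros normal_derivative[OF p])
  moreover have "\<forall>\<^sub>F x in nhds p. N x \<bullet> N x = 1"
    using grad_nonzero_nearby[OF p]
    by eventually_elim (simp add: unit_normal_def flip: power2_norm_eq_inner)
  then have "((\<lambda>x. N x \<bullet> N x) has_derivative (\<lambda>h. 0)) (at p)"
    by (intro has_derivative_transform_eventually[OF has_derivative_const[of 1]])
       (auto simp: eventually_nhds_conv_at elim: eventually_mono)
  ultimately have "(\<lambda>h. N p \<bullet> A p h + A p h \<bullet> N p) = (\<lambda>h. 0)"
    by (rule has_derivative_unique)
  then have "N p \<bullet> A p u + A p u \<bullet> N p = 0" by meson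
  then show ?thesis by (simp add: inner_commute)
qed

text \<open>Against tangent vectors the shape operator is the Hessian divided by the length of the
  gradient: the term from differentiating that length carries the factor
  \<open>N p \<bullet> z\<close>, which is zero.\<close>

lemma shape_symmetric:
  assumes p: "p \<in> surf F" and u: "u \<bullet> N p = 0" and w: "w \<bullet> N p = 0"
  shows "A p u \<bullet> w = A p w \<bullet> u"
proof -
  define H where "H = frechet_derivative (grad F) (at p)"
  have dH: "(grad F has_derivative H) (at p)" using smooth_hessian(1)[OF smooth] by (simp add: H_def)
  have *: "norm (grad F p) * (A p h \<bullet> z) = H h \<bullet> z" if z: "z \<bullet> N p = 0" for z h
  proof -
    have "(norm has_derivative (\<lambda>h. h \<bullet> sgn (grad F p))) (at (grad F p))"
      using grad_nonzero[OF p] has_derivative_norm by blast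
    then obtain m where m: "((\<lambda>x. norm (grad F x)) has_derivative m) (at p)"
      using has_derivative_compose[OF dH] by blast
    have "((\<lambda>x. norm (grad F x) * (N x \<bullet> z)) has_derivative
       (\<lambda>h. norm (grad F p) * (A p h \<bullet> z) + m h * (N p \<bullet> z))) (at p)"
      by (intro derivative_intros normal_derivative[OF p] m has_derivative_inner_left)
    moreover have "\<forall>\<^sub>F x in nhds p. grad F x \<bullet> z = norm (grad F x) * (N x \<bullet> z)"
      using grad_nonzero_nearby[OF p] by eventually_elim (simp add: unit_normal_def)
    then have "((\<lambda>x. norm (grad F x) * (N x \<bullet> z)) has_derivative (\<lambda>h. H h \<bullet> z)) (at p)"
      by (intro has_derivative_transform_eventually[OF has_derivative_inner_left[OF dH]])
         (auto simp: eventually_nhds_conv_at elim: eventually_mono)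
    ultimately have "(\<lambda>h. norm (grad F p) * (A p h \<bullet> z) + m h * (N p \<bullet> z)) = (\<lambda>h. H h \<bullet> z)"
      by (rule has_derivative_unique)
    then have "norm (grad F p) * (A p h \<bullet> z) + m h * (N p \<bullet> z) = H h \<bullet> z" by meson
    then show ?thesis using z by (simp add: inner_commute)
  qed
  have "norm (grad F p) * (A p u \<bullet> w) = norm (grad F p) * (A p w \<bullet> u)"
    using *[OF w] *[OF u] smooth_hessian(2)[OF smooth] by (simp add: H_def)
  then show ?thesis using grad_nonzero[OF p] by simp
qed

section \<open>Supporting half-spaces\<close>

text \<open>If the product were positive, \<open>F\<close> would become positive on the segment from
  \<open>p\<close> to \<open>z\<close>, which convexity keeps inside the body.\<close>

lemma supporting_halfspace:
  assumes p: "p \<in> surf F" and z: "z \<in> body F"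
  shows "grad F p \<bullet> (z - p) \<le> 0"
proof (rule ccontr)
  assume "\<not> ?thesis"
  then have "0 < grad F (p + 0 *\<^sub>R (z - p)) \<bullet> (z - p)" by simp
  then obtain e where e: "e > 0" "\<And>h. 0 < h \<Longrightarrow> h < e \<Longrightarrow> F (p + 0 *\<^sub>R (z-p)) < F (p + (0 + h) *\<^sub>R (z - p))"
    using DERIV_pos_inc_right[OF F_line_derivative] by blast
  define h where "h = min (e/2) 1"
  have h: "0 < h" "h < e" "h \<le> 1" using e(1) by (auto simp: h_def)
  have "(1 - h) *\<^sub>R p + h *\<^sub>R z \<in> body F"
    using convexD[OF convex_body surf_body[OF p] z, of "1-h" h] h by simp
  then have "F (p + h *\<^sub>R (z - p)) \<le> 0" by (simp add: body_def algebra_simps)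
  then show False using e(2)[OF h(1,2)] p by (simp add: surf_def)
qed

text \<open>An interior point can be pushed by \<open>e\<close> along the gradient without leaving
  the body; the weak inequality for the pushed point is the strict one for \<open>z\<close>.\<close>

lemma supporting_halfspace_interior:
  assumes p: "p \<in> surf F" and z: "z \<in> interior (body F)"
  shows "grad F p \<bullet> (z - p) < 0"
proof -
  obtain e where e: "e > 0" "cball z e \<subseteq> body F" using z by (auto simp: mem_interior_cball)
  define y where "y = z + (e / norm (grad F p)) *\<^sub>R grad F p"
  have "y \<in> body F" using e grad_nonzero[OF p] by (intro subsetD[OF e(2)]) (simp add: y_def dist_norm)
  then have "grad F p \<bullet> (y - p) \<le> 0" using supporting_halfspace[OF p] by blast
  moreover have "grad F p \<bullet> (y - p) = grad F p \<bullet> (z - p) + e * norm (grad F p)"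
    using grad_nonzero[OF p]
    by (simp add: y_def inner_add_right inner_diff_right power2_norm_eq_inner[symmetric] power2_eq_square)
  ultimately show ?thesis using e(1) grad_nonzero[OF p] by (smt (verit) mult_pos_pos zero_less_norm_iff)
qed

section \<open>Exit times of rays\<close>

text \<open>This covers rays that start in the interior as well as rays from a boundary point
  pointing inwards, so one exit time serves both the radial projection and the chords.\<close>

definition enters :: "'a \<Rightarrow> 'a \<Rightarrow> bool" where
  "enters x d \<longleftrightarrow> (\<exists>e>0. \<forall>t. 0 < t \<and> t < e \<longrightarrow> F (x + t *\<^sub>R d) < 0)"

lemma enters_interior: "F x < 0 \<Longrightarrow> enters x d"
proof -
  assume x: "F x < 0"
  have "((\<lambda>t. F (x + t *\<^sub>R d)) \<longlongrightarrow> F (x + 0 *\<^sub>R d)) (at 0)"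
    using DERIV_isCont[OF F_line_derivative[of x d 0]] unfolding isCont_def .
  then have "\<forall>\<^sub>F t in at 0. F (x + t *\<^sub>R d) < 0" by (rule order_tendstoD) (simp add: x)
  then show ?thesis by (auto simp: enters_def eventually_at dist_real_def)
qed

lemma enters_boundary: "p \<in> surf F \<Longrightarrow> N p \<bullet> d < 0 \<Longrightarrow> enters p d"
proof -
  assume p: "p \<in> surf F" "N p \<bullet> d < 0"
  then have "grad F (p + 0 *\<^sub>R d) \<bullet> d < 0"
    using grad_nonzero normal_inner by (simp add: mult_pos_neg)
  then show ?thesis
    using DERIV_neg_dec_right[OF F_line_derivative[of p d 0]] p(1) by (auto simp: enters_def surf_def)
qed

definition exit_time :: "'a \<Rightarrow> 'a \<Rightarrow> real" where
  "exit_time x d = (THE t. t > 0 \<and> x + t *\<^sub>R d \<in> surf F)"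

text \<open>The earlier hit lies strictly between an interior point of the ray and the later hit,
  hence in the interior of the convex body, where no point of \<open>surf F\<close> lies.\<close>

lemma exit_unique_aux:
  assumes "enters x d" "0 < a" "a < b" "x + a *\<^sub>R d \<in> surf F" "x + b *\<^sub>R d \<in> surf F"
  shows False
proof -
  obtain e where e: "e > 0" "\<And>t. 0 < t \<Longrightarrow> t < e \<Longrightarrow> F (x + t *\<^sub>R d) < 0"
    using assms(1) by (auto simp: enters_def)
  define t where "t = min (e/2) (a/2)"
  have t: "0 < t" "t < e" "t < a" using e(1) assms(2) by (auto simp: t_def)
  have "x + t *\<^sub>R d \<in> interior (body F)" using negative_interior e(2) t by blast
  moreover have "x + b *\<^sub>R d \<in> closure (body F)"
    using surf_body[OF assms(5)] closure_subset by blast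
  ultimately have sub: "open_segment (x + t *\<^sub>R d) (x + b *\<^sub>R d) \<subseteq> interior (body F)"
    using in_interior_closure_convex_segment[OF convex_body] by blast
  define u where "u = (a - t) / (b - t)"
  have u: "0 < u" "u < 1" using t assms(3) by (auto simp: u_def)
  have ueq: "u * (b - t) = a - t" using t assms(3) by (simp add: u_def)
  have "(1 - u) *\<^sub>R (x + t *\<^sub>R d) + u *\<^sub>R (x + b *\<^sub>R d) = x + (t + u * (b - t)) *\<^sub>R d"
    by (simp add: algebra_simps)
  then have eq: "x + a *\<^sub>R d = (1 - u) *\<^sub>R (x + t *\<^sub>R d) + u *\<^sub>R (x + b *\<^sub>R d)"
    using ueq by simp
  have "x + t *\<^sub>R d \<noteq> x + b *\<^sub>R d"
    using e(2)[OF t(1,2)] assms(5) by (auto simp: surf_def)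
  then have "x + a *\<^sub>R d \<in> open_segment (x + t *\<^sub>R d) (x + b *\<^sub>R d)"
    unfolding in_segment using u eq by blast
  then show False using sub surf_not_interior assms(4) by blast
qed

lemma exit_unique:
  assumes "enters x d" "0 < a" "0 < b" "x + a *\<^sub>R d \<in> surf F" "x + b *\<^sub>R d \<in> surf F"
  shows "a = b"
  using assms exit_unique_aux by (meson linorder_neqE)

lemma exit_exists:
  assumes en: "enters x d" and d: "d \<noteq> 0"
  shows "\<exists>t>0. x + t *\<^sub>R d \<in> surf F"
proof -
  obtain e where e: "e > 0" "\<And>t. 0 < t \<Longrightarrow> t < e \<Longrightarrow> F (x + t *\<^sub>R d) < 0"
    using en by (auto simp: enters_def)
  obtain B where B: "\<And>y. y \<in> body F \<Longrightarrow> norm y \<le> B"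
    using compact_imp_bounded[OF compact_body] by (auto simp: bounded_iff)
  \<comment> \<open>The second entry makes \<open>norm (x + T *\<^sub>R d)\<close> exceed the bound
    \<open>B\<close> of the body; the first keeps \<open>T\<close> to the right of
    \<open>e/2\<close>.\<close>
  define T where "T = max e ((\<bar>B\<bar> + norm x + 1) / norm d)"
  have "(\<bar>B\<bar> + norm x + 1) / norm d \<le> T" by (simp add: T_def)
  then have "\<bar>B\<bar> + norm x + 1 \<le> T * norm d" using d by (simp add: divide_le_eq)
  also have "T * norm d \<le> \<bar>T\<bar> * norm d" by (simp add: mult_right_mono)
  also have "\<dots> \<le> norm (x + T *\<^sub>R d) + norm x"
    using norm_triangle_ineq4[of "x + T *\<^sub>R d" x] by simp
  finally have "\<not> norm (x + T *\<^sub>R d) \<le> B" by linarith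
  then have T: "F (x + T *\<^sub>R d) > 0" using B by (force simp: body_def)
  have "e \<le> T" by (simp add: T_def)
  then have eT: "e/2 < T" using e(1) by linarith
  have "\<exists>t. e/2 \<le> t \<and> t \<le> T \<and> F (x + t *\<^sub>R d) = 0"
    by (rule IVT[where f="\<lambda>t. F (x + t *\<^sub>R d)"])
       (use e eT T DERIV_isCont[OF F_line_derivative] in \<open>auto intro: less_imp_le\<close>)
  then obtain t where "e/2 \<le> t" "F (x + t *\<^sub>R d) = 0" by blast
  then show ?thesis using e(1) by (intro exI[of _ t]) (auto simp: surf_def)
qed

lemma exit_time:
  assumes "enters x d" "d \<noteq> 0"
  shows exit_time_pos: "exit_time x d > 0" and exit_time_surf: "x + exit_time x d *\<^sub>R d \<in> surf F"
proof -
  have "\<exists>!t. t > 0 \<and> x + t *\<^sub>R d \<in> surf F"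
    using exit_exists[OF assms] exit_unique[OF assms(1)] by blast
  from theI'[OF this] show "exit_time x d > 0" "x + exit_time x d *\<^sub>R d \<in> surf F"
    by (auto simp: exit_time_def)
qed

lemma exit_time_eqI:
  assumes "enters x d" "t > 0" "x + t *\<^sub>R d \<in> surf F"
  shows "exit_time x d = t"
  unfolding exit_time_def using assms exit_unique by blast

text \<open>The ray passed through an interior point shortly after its start, and the supporting
  inequality at the exit point is strict for interior points.\<close>

lemma exit_transversal:
  assumes en: "enters x d" and t: "t > 0" "x + t *\<^sub>R d \<in> surf F"
  shows "grad F (x + t *\<^sub>R d) \<bullet> d > 0"
proof -
  obtain e where e: "e > 0" "\<And>t. 0 < t \<Longrightarrow> t < e \<Longrightarrow> F (x + t *\<^sub>R d) < 0"
    using en by (auto simp: enters_def)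
  define h where "h = min (e/2) (t/2)"
  have h: "0 < h" "h < e" "h < t" using e(1) t(1) by (auto simp: h_def)
  have "grad F (x + t *\<^sub>R d) \<bullet> ((x + h *\<^sub>R d) - (x + t *\<^sub>R d)) < 0"
    using supporting_halfspace_interior[OF t(2)] negative_interior e(2) h by blast
  moreover have "(x + h *\<^sub>R d) - (x + t *\<^sub>R d) = (h - t) *\<^sub>R d" by (simp add: algebra_simps)
  ultimately show ?thesis using h by (simp add: mult_less_0_iff)
qed

text \<open>\<open>F\<close> changes sign between \<open>T t0 - h\<close> and
  \<open>T t0 + h\<close> on the ray at \<open>t0\<close>, and by continuity also on nearby rays.
  The root caught in between is the exit time, by uniqueness.\<close>

lemma exit_time_isCont:
  fixes x d :: "real \<Rightarrow> 'a"
  assumes en: "\<And>t. enters (x t) (d t)" and d: "\<And>t. d t \<noteq> 0"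
    and xc: "isCont x t0" and dc: "isCont d t0"
  shows "isCont (\<lambda>t. exit_time (x t) (d t)) t0"
proof -
  define T where "T t = exit_time (x t) (d t)" for t
  have T: "T t > 0" "x t + T t *\<^sub>R d t \<in> surf F" for t
    using exit_time[OF en d] by (auto simp: T_def)
  have pos: "grad F (x t0 + T t0 *\<^sub>R d t0) \<bullet> d t0 > 0" using exit_transversal[OF en T] .
  obtain a where a: "a > 0" "\<And>h. 0 < h \<Longrightarrow> h < a \<Longrightarrow> F (x t0 + T t0 *\<^sub>R d t0) < F (x t0 + (T t0 + h) *\<^sub>R d t0)"
    using DERIV_pos_inc_right[OF F_line_derivative pos] by blast
  obtain b where b: "b > 0" "\<And>h. 0 < h \<Longrightarrow> h < b \<Longrightarrow> F (x t0 + (T t0 - h) *\<^sub>R d t0) < F (x t0 + T t0 *\<^sub>R d t0)"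
    using DERIV_pos_inc_left[OF F_line_derivative pos] by blast
  have F0: "F (x t0 + T t0 *\<^sub>R d t0) = 0" using T by (simp add: surf_def)
  have lim: "((\<lambda>t. F (x t + \<rho> *\<^sub>R d t)) \<longlongrightarrow> F (x t0 + \<rho> *\<^sub>R d t0)) (at t0)" for \<rho>
  proof -
    have "isCont (\<lambda>t. x t + \<rho> *\<^sub>R d t) t0" by (intro continuous_intros xc dc)
    then have "isCont (\<lambda>t. F (x t + \<rho> *\<^sub>R d t)) t0" using isCont_F by (rule isCont_o2)
    then show ?thesis by (simp add: isCont_def)
  qed
  have "(T \<longlongrightarrow> T t0) (at t0)"
  proof (rule tendstoI)
    fix \<epsilon> :: real assume \<epsilon>: "\<epsilon> > 0"
    \<comment> \<open>The entry \<open>T t0/2\<close> keeps the lower end \<open>T t0 - h\<close>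
      positive, so the root found is an admissible exit time.\<close>
    define h where "h = Min {\<epsilon>/2, a/2, b/2, T t0/2}"
    have h: "0 < h" "h < \<epsilon>" "h < a" "h < b" "h < T t0"
      using \<epsilon> a(1) b(1) T(1)[of t0] by (auto simp: h_def min_def)
    have "\<forall>\<^sub>F t in at t0. F (x t + (T t0 + h) *\<^sub>R d t) > 0"
      using a(2) h F0 by (intro order_tendstoD(1)[OF lim]) auto
    moreover have "\<forall>\<^sub>F t in at t0. F (x t + (T t0 - h) *\<^sub>R d t) < 0"
      using b(2) h F0 by (intro order_tendstoD(2)[OF lim]) auto
    ultimately show "\<forall>\<^sub>F t in at t0. dist (T t) (T t0) < \<epsilon>"
    proof eventually_elim
      case (elim t)
      have "\<exists>\<rho>. T t0 - h \<le> \<rho> \<and> \<rho> \<le> T t0 + h \<and> F (x t + \<rho> *\<^sub>R d t) = 0"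
        by (rule IVT[where f="\<lambda>\<rho>. F (x t + \<rho> *\<^sub>R d t)"])
          (use elim h DERIV_isCont[OF F_line_derivative] in auto)
      then obtain \<rho> where \<rho>: "T t0 - h \<le> \<rho>" "\<rho> \<le> T t0 + h" "x t + \<rho> *\<^sub>R d t \<in> surf F"
        by (auto simp: surf_def)
      then have "T t = \<rho>" using h exit_time_eqI[OF en] by (simp add: T_def)
      then show ?case using \<rho> h by (simp add: dist_real_def)
    qed
  qed
  then show ?thesis unfolding isCont_def T_def .
qed

lemma exit_time_derivative:
  fixes x d :: "real \<Rightarrow> 'a"
  assumes en: "\<And>t. enters (x t) (d t)" and d: "\<And>t. d t \<noteq> 0"
    and x': "(x has_vector_derivative x') (at t0)" and d': "(d has_vector_derivative d') (at t0)"
  defines "T \<equiv> \<lambda>t. exit_time (x t) (d t)"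
  defines "q \<equiv> x t0 + T t0 *\<^sub>R d t0"
  shows "(T has_real_derivative - (N q \<bullet> (x' + T t0 *\<^sub>R d')) / (N q \<bullet> d t0)) (at t0)"
proof -
  have T: "T t > 0" "x t + T t *\<^sub>R d t \<in> surf F" for t
    using exit_time[OF en d] by (auto simp: T_def)
  have q: "q \<in> surf F" using T by (simp add: q_def)
  have "isCont T t0" unfolding T_def
    using x' d' has_vector_derivative_continuous by (intro exit_time_isCont en d) blast+
  moreover have "grad F q \<bullet> d t0 \<noteq> 0"
    using exit_transversal[OF en T] unfolding q_def by (metis less_irrefl)
  ultimately have "(T has_real_derivative - (grad F q \<bullet> (x' + T t0 *\<^sub>R d')) / (grad F q \<bullet> d t0)) (at t0)"
    using T(2) unfolding q_def
    by (intro implicit_root_derivative[OF F_derivative x' d']) (auto simp: surf_def)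
  then show ?thesis using grad_nonzero[OF q] by (simp add: normal_inner[OF q])
qed

section \<open>Curves on the hypersurface\<close>

lemma negative_point: "\<exists>x. F x < 0"
proof -
  obtain p where p: "p \<in> surf F" using surf_nonempty by blast
  then have "N p \<bullet> (- N p) < 0" by (simp add: normal_inner_normal)
  then obtain e where "e > 0" "\<forall>t. 0 < t \<and> t < e \<longrightarrow> F (p + t *\<^sub>R (- N p)) < 0"
    using enters_boundary[OF p] unfolding enters_def by blast
  then show ?thesis by (meson field_lbound_gt_zero)
qed

text \<open>Central projection from the interior point \<open>x0\<close> turns any differentiable
  curve avoiding \<open>x0\<close> into a differentiable curve on the hypersurface, defined for all
  times. At a point already on \<open>surf F\<close> the exit time is 1, and a tangential velocity
  there is unchanged.\<close>

lemma radial_curve: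
  fixes x :: "real \<Rightarrow> 'a"
  assumes x0: "F x0 < 0" and ne: "\<And>t. x t \<noteq> x0"
    and x': "\<And>t. x differentiable (at t)"
  defines "\<gamma> \<equiv> \<lambda>t. x0 + exit_time x0 (x t - x0) *\<^sub>R (x t - x0)"
  shows "\<gamma> t \<in> surf F" and "\<gamma> differentiable (at t)"
    and "x t \<in> surf F \<Longrightarrow> \<gamma> t = x t"
    and "x t \<in> surf F \<Longrightarrow> (x has_vector_derivative u) (at t) \<Longrightarrow> N (x t) \<bullet> u = 0 \<Longrightarrow> (\<gamma> has_vector_derivative u) (at t)"
proof -
  define d where "d t = x t - x0" for t
  define T where "T t = exit_time x0 (d t)" for t
  have en: "enters x0 (d t)" for t using enters_interior x0 .
  have dn: "d t \<noteq> 0" for t using ne by (simp add: d_def)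
  have \<gamma>: "\<gamma> = (\<lambda>t. x0 + T t *\<^sub>R d t)" by (simp add: \<gamma>_def T_def d_def)
  show "\<gamma> t \<in> surf F" unfolding \<gamma> T_def using exit_time_surf[OF en dn] by simp
  have T1: "T t = 1" if "x t \<in> surf F"
    unfolding T_def using that by (intro exit_time_eqI en) (auto simp: d_def)
  then show "x t \<in> surf F \<Longrightarrow> \<gamma> t = x t" by (simp add: \<gamma> d_def)
  have dT: "(T has_real_derivative - (N (\<gamma> t) \<bullet> (0 + T t *\<^sub>R u)) / (N (\<gamma> t) \<bullet> d t)) (at t)"
    and d\<gamma>: "(\<gamma> has_vector_derivative (T t *\<^sub>R u + (- (N (\<gamma> t) \<bullet> (0 + T t *\<^sub>R u)) / (N (\<gamma> t) \<bullet> d t)) *\<^sub>R d t)) (at t)"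
    if u: "(x has_vector_derivative u) (at t)" for u
  proof -
    have d': "(d has_vector_derivative u) (at t)" unfolding d_def
      using u by (auto intro!: derivative_eq_intros)
    show *: "(T has_real_derivative - (N (\<gamma> t) \<bullet> (0 + T t *\<^sub>R u)) / (N (\<gamma> t) \<bullet> d t)) (at t)"
      unfolding \<gamma> T_def by (rule exit_time_derivative[OF en dn _ d']) simp
    show "(\<gamma> has_vector_derivative (T t *\<^sub>R u + (- (N (\<gamma> t) \<bullet> (0 + T t *\<^sub>R u)) / (N (\<gamma> t) \<bullet> d t)) *\<^sub>R d t)) (at t)"
      using * d' unfolding \<gamma> by (auto intro!: derivative_eq_intros)
  qed
  show "\<gamma> differentiable (at t)"
    using d\<gamma>[OF vector_derivative_works[THEN iffD1, OF x']] by (rule differentiableI_vector)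
  show "(\<gamma> has_vector_derivative u) (at t)" if "x t \<in> surf F" "(x has_vector_derivative u) (at t)" "N (x t) \<bullet> u = 0"
    using d\<gamma>[OF that(2)] T1[OF that(1)] that(3) by (simp add: \<gamma> d_def)
qed

text \<open>The tangent line through \<open>p\<close> is projected radially. It avoids the centre of
  projection because a tangent hyperplane misses the interior.\<close>

lemma surface_curve:
  assumes p: "p \<in> surf F" and u: "u \<bullet> N p = 0"
  obtains \<gamma> :: "real \<Rightarrow> 'a" where "\<And>t. \<gamma> t \<in> surf F" "\<gamma> 0 = p" "(\<gamma> has_vector_derivative u) (at 0)"
proof -
  obtain x0 where x0: "F x0 < 0" using negative_point by blast
  define x where "x t = p + t *\<^sub>R u" for t :: real
  have x': "(x has_vector_derivative u) (at t)" for t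
    unfolding x_def by (auto intro!: derivative_eq_intros)
  have ne: "x t \<noteq> x0" for t
  proof
    assume "x t = x0"
    then have "x0 - p = t *\<^sub>R u" by (auto simp: x_def)
    then have "grad F p \<bullet> (x0 - p) = 0" using normal_inner[OF p] u by (simp add: inner_commute)
    then show False using supporting_halfspace_interior[OF p negative_interior[OF x0]] by simp
  qed
  have df: "\<And>t. x differentiable (at t)" using x' by (meson differentiableI_vector)
  have "x 0 = p" by (simp add: x_def)
  then show thesis
    using radial_curve(1)[where x=x, OF x0 ne df] radial_curve(3,4)[where x=x and t=0, OF x0 ne df] x' p u
    by (intro that[of "\<lambda>t. x0 + exit_time x0 (x t - x0) *\<^sub>R (x t - x0)"]) (simp_all add: inner_commute)
qed

end

context convex_table
begin

lemma surface_curve_tangent: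
  assumes S: "\<And>t. \<gamma> t \<in> surf F" and d: "(\<gamma> has_vector_derivative u) (at (t::real))"
  shows "N (\<gamma> t) \<bullet> u = 0"
proof -
  have "((\<lambda>t. F (\<gamma> t)) has_derivative (\<lambda>h. grad F (\<gamma> t) \<bullet> (h *\<^sub>R u))) (at t)"
    using d unfolding has_vector_derivative_def by (rule has_derivative_compose[OF _ F_derivative])
  moreover have "(\<lambda>t. F (\<gamma> t)) = (\<lambda>_. 0)" using S by (auto simp: surf_def)
  ultimately have "(\<lambda>h. grad F (\<gamma> t) \<bullet> (h *\<^sub>R u)) = (\<lambda>_. 0)"
    using has_derivative_unique has_derivative_const by metis
  then have "grad F (\<gamma> t) \<bullet> (1 *\<^sub>R u) = 0" by meson
  then show ?thesis using normal_inner[OF S] grad_nonzero[OF S] by simp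
qed

lemma normal_curve_derivative:
  assumes S: "\<And>t. \<gamma> t \<in> surf F" and d: "(\<gamma> has_vector_derivative u) (at (t::real))"
  shows "((\<lambda>t. N (\<gamma> t)) has_vector_derivative A (\<gamma> t) u) (at t)"
proof -
  have "((\<lambda>t. N (\<gamma> t)) has_derivative (\<lambda>h. A (\<gamma> t) (h *\<^sub>R u))) (at t)"
    using d unfolding has_vector_derivative_def by (rule has_derivative_compose[where f=\<gamma>, OF _ normal_derivative[OF S[of t]]])
  then show ?thesis
    by (simp add: has_vector_derivative_def linear_scale[OF linear_shape[OF S]])
qed

section \<open>Unit tangent vectors along curves and the linearised angle condition\<close>

definition unit_tangent :: "'a \<Rightarrow> 'a \<Rightarrow> bool" where
  "unit_tangent p v \<longleftrightarrow> p \<in> surf F \<and> v \<bullet> v = 1 \<and> v \<bullet> N p = 0"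

lemma unit_tangentD:
  assumes "unit_tangent p v"
  shows "p \<in> surf F" "v \<bullet> v = 1" "v \<bullet> N p = 0" "N p \<bullet> v = 0" "N p \<bullet> N p = 1"
  using assms normal_inner_normal by (auto simp: unit_tangent_def inner_commute)

lemma unit_tangent_minus: "unit_tangent p v \<Longrightarrow> unit_tangent p (- v)"
  by (simp add: unit_tangent_def)

lemma unit_tangent_rotate:
  assumes "unit_tangent p v" "unit_tangent p w" "v \<bullet> w = 0"
  shows "unit_tangent p (cos \<theta> *\<^sub>R v + sin \<theta> *\<^sub>R w)"
proof -
  have "cos \<theta> * cos \<theta> + sin \<theta> * sin \<theta> = 1"
    using sin_cos_squared_add2[of \<theta>] by (simp add: power2_eq_square)
  then show ?thesis
    using assms unfolding unit_tangent_def by (simp add: inner_add_left inner_add_right inner_commute[of w v])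
qed

text \<open>First-order substitute for parallel transport: \<open>v\<close> is projected to the
  tangent spaces along \<open>\<gamma>\<close> and normalised. Far from \<open>t0\<close> the
  projection may vanish; any unit tangent vector is chosen there, which does not affect the
  derivative at \<open>t0\<close>. That derivative is normal to the hypersurface, so normalisation
  does not change it.\<close>

lemma transport:
  assumes S: "\<And>t. \<gamma> t \<in> surf F" and d: "(\<gamma> has_vector_derivative u) (at t0)"
    and v: "unit_tangent (\<gamma> t0) v" and ex: "\<And>t. \<exists>w. unit_tangent (\<gamma> t) w"
  obtains V :: "real \<Rightarrow> 'a" where "\<And>t. unit_tangent (\<gamma> t) (V t)" "V t0 = v"
    "(V has_vector_derivative - (v \<bullet> A (\<gamma> t0) u) *\<^sub>R N (\<gamma> t0)) (at t0)"
proof -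
  define P where "P t = v - (v \<bullet> N (\<gamma> t)) *\<^sub>R N (\<gamma> t)" for t
  define V where "V t = (if P t = 0 then SOME w. unit_tangent (\<gamma> t) w else P t /\<^sub>R norm (P t))" for t
  have v': "v \<bullet> N (\<gamma> t0) = 0" "v \<bullet> v = 1" using unit_tangentD[OF v] by auto
  have P0: "P t0 = v" using v' by (simp add: P_def)
  have vn: "norm v = 1" "v \<noteq> 0" using v'(2) by (auto simp: norm_eq_1)
  have "unit_tangent (\<gamma> t) (V t)" for t
  proof (cases "P t = 0")
    case True then show ?thesis using someI_ex[OF ex] by (simp add: V_def)
  next
    case False
    moreover have "P t \<bullet> N (\<gamma> t) = 0"
      by (simp add: P_def inner_diff_left normal_inner_normal[OF S])
    ultimately show ?thesis using S
      by (simp add: V_def unit_tangent_def flip: power2_norm_eq_inner)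
  qed
  moreover have "V t0 = v" using vn by (simp add: V_def P0)
  moreover have "(V has_vector_derivative - (v \<bullet> A (\<gamma> t0) u) *\<^sub>R N (\<gamma> t0)) (at t0)"
  proof -
    have dP: "(P has_vector_derivative - (v \<bullet> A (\<gamma> t0) u) *\<^sub>R N (\<gamma> t0)) (at t0)"
    proof -
      have "((\<lambda>t. v \<bullet> N (\<gamma> t)) has_real_derivative v \<bullet> A (\<gamma> t0) u) (at t0)"
        using bounded_linear.has_vector_derivative[OF bounded_linear_inner_right normal_curve_derivative[OF S d]]
        by (simp add: has_real_derivative_iff_has_vector_derivative)
      then show ?thesis unfolding P_def
        using normal_curve_derivative[OF S d] v'(1) by (auto intro!: derivative_eq_intros)
    qed
    have "(norm has_derivative (\<lambda>h. h \<bullet> sgn v)) (at (P t0))"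
      using vn has_derivative_norm unfolding P0 by blast
    then have "((\<lambda>t. norm (P t)) has_derivative (\<lambda>h. (h *\<^sub>R (- (v \<bullet> A (\<gamma> t0) u) *\<^sub>R N (\<gamma> t0))) \<bullet> sgn v)) (at t0)"
      using dP unfolding has_vector_derivative_def by (rule has_derivative_compose[rotated])
    then have "((\<lambda>t. norm (P t)) has_real_derivative 0) (at t0)"
      using v' vn by (simp add: has_field_derivative_def sgn_div_norm inner_commute lambda_zero)
    then have "((\<lambda>t. P t /\<^sub>R norm (P t)) has_vector_derivative - (v \<bullet> A (\<gamma> t0) u) *\<^sub>R N (\<gamma> t0)) (at t0)"
      using dP vn by (auto intro!: derivative_eq_intros simp: P0)
    moreover have "\<forall>\<^sub>F t in nhds t0. P t /\<^sub>R norm (P t) = V t"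
    proof -
      have "isCont P t0" using dP has_vector_derivative_continuous by blast
      then have "\<forall>\<^sub>F t in nhds t0. P t \<noteq> 0"
        using vn P0 by (metis isCont_def tendsto_imp_eventually_ne tendsto_at_iff_tendsto_nhds)
      then show ?thesis by eventually_elim (simp add: V_def)
    qed
    ultimately show ?thesis
      unfolding has_vector_derivative_def
      by (elim has_derivative_transform_eventually)
        (auto simp: eventually_nhds_conv_at elim: eventually_mono)
  qed
  ultimately show thesis by (rule that)
qed

text \<open>The linearisation of the constraint that the chord from \<open>p\<close> to \<open>q\<close> makes a fixed angle with the
  hypersurface at \<open>p\<close>. Squaring the constraint avoids differentiating the norm.\<close>

lemma constant_angle_variation:
  assumes pS: "\<And>t. p t \<in> surf F"
    and dp: "(p has_vector_derivative p') (at (t0::real))" and dq: "(q has_vector_derivative q') (at t0)"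
    and angle: "\<And>t. N (p t) \<bullet> (p t - q t) = \<sigma> * norm (p t - q t)" and \<sigma>: "\<sigma> > 0" and L: "L > 0"
    and om: "q t0 - p t0 = L *\<^sub>R \<omega>" "\<omega> \<bullet> \<omega> = 1"
  shows "(\<sigma> *\<^sub>R \<omega> + N (p t0)) \<bullet> q' = \<sigma> * (\<omega> \<bullet> p') - L * (A (p t0) p' \<bullet> \<omega>)"
proof -
  define X where "X = A (p t0) p' \<bullet> (p t0 - q t0) + N (p t0) \<bullet> (p' - q')"
  define f where "f t = N (p t) \<bullet> (p t - q t)" for t
  have "(f has_vector_derivative X) (at t0)"
    unfolding f_def X_def has_vector_derivative_def
    by (rule has_derivative_eq_rhs[OF has_derivative_inner[OF
        normal_curve_derivative[OF pS dp, unfolded has_vector_derivative_def]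
        has_derivative_diff[OF dp[unfolded has_vector_derivative_def] dq[unfolded has_vector_derivative_def]]]])
      (simp add: fun_eq_iff algebra_simps)
  then have "((\<lambda>t. (f t)\<^sup>2) has_real_derivative 2 * f t0 * X) (at t0)"
    by (auto intro!: derivative_eq_intros simp: has_real_derivative_iff_has_vector_derivative[symmetric])
  moreover have "(\<lambda>t. (f t)\<^sup>2) = (\<lambda>t. \<sigma>\<^sup>2 * ((p t - q t) \<bullet> (p t - q t)))"
    by (simp add: f_def angle power_mult_distrib power2_norm_eq_inner)
  moreover have "((\<lambda>t. \<sigma>\<^sup>2 * ((p t - q t) \<bullet> (p t - q t))) has_real_derivative \<sigma>\<^sup>2 * (2 * ((p t0 - q t0) \<bullet> (p' - q')))) (at t0)"
    unfolding has_field_derivative_def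
    by (rule has_derivative_eq_rhs[OF has_derivative_mult_right[OF has_derivative_inner[OF
        has_derivative_diff[OF dp[unfolded has_vector_derivative_def] dq[unfolded has_vector_derivative_def]]
        has_derivative_diff[OF dp[unfolded has_vector_derivative_def] dq[unfolded has_vector_derivative_def]]]]])
      (simp add: fun_eq_iff algebra_simps inner_commute)
  ultimately have eq: "2 * f t0 * X = \<sigma>\<^sup>2 * (2 * ((p t0 - q t0) \<bullet> (p' - q')))"
    by (metis DERIV_unique)
  have pq: "p t0 - q t0 = - (L *\<^sub>R \<omega>)" using om(1) by (metis minus_diff_eq)
  have "norm (p t0 - q t0) = L" using L om(2) by (simp add: pq norm_eq_1[symmetric])
  then have f0: "f t0 = \<sigma> * L" by (simp add: f_def angle)
  define Z where "Z = \<omega> \<bullet> (p' - q')"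
  have Z: "(p t0 - q t0) \<bullet> (p' - q') = - (L * Z)" unfolding pq Z_def by simp
  \<comment> \<open>The common factor \<open>2 * \<sigma> * L\<close> produced by squaring is
    nonzero and cancels.\<close>
  have "(2 * \<sigma> * L) * X = (2 * \<sigma> * L) * (- \<sigma> * Z)"
    using eq unfolding f0 Z power2_eq_square by (simp only: ac_simps mult_minus_left mult_minus_right)
  moreover have "2 * \<sigma> * L \<noteq> 0" using \<sigma> L by simp
  ultimately have "X = - \<sigma> * Z" using mult_left_cancel by blast
  then have "X = - \<sigma> * (\<omega> \<bullet> (p' - q'))" by (simp add: Z_def)
  moreover have "N (p t0) \<bullet> p' = 0" using surface_curve_tangent[OF pS dp] .
  ultimately show ?thesis
    by (simp add: X_def pq inner_diff_right inner_add_left) (simp add: algebra_simps)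
qed

end

section \<open>Chords leaving at the angle \<delta> and their reversal\<close>

locale gutkin = convex_table F for F :: "'a::euclidean_space \<Rightarrow> real" +
  fixes \<delta> :: real
  assumes dim: "DIM('a) > 3" and table: "gutkin_table F \<delta>"
begin

abbreviation sn :: real where "sn \<equiv> sin \<delta>"
abbreviation cs :: real where "cs \<equiv> cos \<delta>"

lemma delta: "0 < \<delta>" "\<delta> < pi / 2"
  using table by (auto simp: gutkin_table_def)

lemma sn_pos: "sn > 0" and cs_pos: "cs > 0"
  using delta by (auto intro!: sin_gt_zero cos_gt_zero)

lemma sn_cs: "sn * sn + cs * cs = 1"
  using sin_cos_squared_add[of \<delta>] by (simp add: power2_eq_square)

text \<open>\<open>\<mu>\<close> is the unit vector with \<open>N (tip p v) = sn *\<^sub>R dir p v - cs *\<^sub>R \<mu> p v\<close>, and \<open>rev_dir p v\<close> is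
  the tangent direction at the end point whose chord is the reversed one.\<close>

definition dir :: "'a \<Rightarrow> 'a \<Rightarrow> 'a" where "dir p v = cs *\<^sub>R v - sn *\<^sub>R N p"
definition len :: "'a \<Rightarrow> 'a \<Rightarrow> real" where "len p v = exit_time p (dir p v)"
definition tip :: "'a \<Rightarrow> 'a \<Rightarrow> 'a" where "tip p v = p + len p v *\<^sub>R dir p v"
definition \<mu> :: "'a \<Rightarrow> 'a \<Rightarrow> 'a" where "\<mu> p v = (sn *\<^sub>R dir p v - N (tip p v)) /\<^sub>R cs"
definition rev_dir :: "'a \<Rightarrow> 'a \<Rightarrow> 'a" where "rev_dir p v = (sn *\<^sub>R N (tip p v) - dir p v) /\<^sub>R cs"

lemma dir_inner:
  assumes "unit_tangent p v"
  shows "dir p v \<bullet> dir p v = 1" "dir p v \<bullet> N p = - sn" "N p \<bullet> dir p v = - sn" "dir p v \<bullet> v = cs" "v \<bullet> dir p v = cs"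
  using unit_tangentD[OF assms] sn_cs
  by (auto simp: dir_def inner_diff_left inner_diff_right algebra_simps)

lemma dir_inner_tangent: "w \<bullet> N p = 0 \<Longrightarrow> dir p v \<bullet> w = cs * (v \<bullet> w)"
  by (simp add: dir_def inner_diff_left inner_commute[of "N p"])

lemma dir_enters:
  assumes "unit_tangent p v"
  shows "enters p (dir p v)" "dir p v \<noteq> 0"
  using enters_boundary dir_inner[OF assms] unit_tangentD(1)[OF assms] sn_pos by auto

lemma len_pos: "unit_tangent p v \<Longrightarrow> len p v > 0"
  and tip_surf: "unit_tangent p v \<Longrightarrow> tip p v \<in> surf F"
  using exit_time dir_enters by (auto simp: len_def tip_def)

lemma hyperplane_angle_chord:
  assumes q: "q \<in> surf F" and "L > 0" "\<omega> \<bullet> \<omega> = 1"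
  shows "hyperplane_angle (L *\<^sub>R \<omega>) (grad F q) = arcsin \<bar>\<omega> \<bullet> N q\<bar>"
proof -
  have "norm \<omega> = 1" using assms(3) by (simp add: norm_eq_1)
  moreover have "(L *\<^sub>R \<omega>) \<bullet> grad F q = L * norm (grad F q) * (\<omega> \<bullet> N q)"
    using normal_inner[OF q, of \<omega>] by (simp add: inner_commute)
  ultimately show ?thesis
    using assms(2) grad_nonzero[OF q] by (simp add: hyperplane_angle_def abs_mult)
qed

text \<open>The table condition gives only the absolute value of the product, since
  \<open>hyperplane_angle\<close> is unsigned. The sign comes from the chord leaving the body at its
  tip.\<close>

lemma tip_normal:
  assumes v: "unit_tangent p v"
  shows "N (tip p v) \<bullet> dir p v = sn" "dir p v \<bullet> N (tip p v) = sn"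
proof -
  define q \<omega> L where "q = tip p v" and "\<omega> = dir p v" and "L = len p v"
  have p: "p \<in> surf F" using unit_tangentD[OF v] by blast
  have q: "q \<in> surf F" using tip_surf[OF v] by (simp add: q_def)
  have L: "L > 0" using len_pos[OF v] by (simp add: L_def)
  have om: "\<omega> \<bullet> \<omega> = 1" "\<omega> \<bullet> N p = - sn" using dir_inner[OF v] by (auto simp: \<omega>_def)
  have qp: "q - p = L *\<^sub>R \<omega>" by (simp add: q_def \<omega>_def L_def tip_def)
  have "q \<noteq> p" using qp L om(1) by auto
  moreover have "hyperplane_angle (q - p) (grad F p) = \<delta>"
    using delta sn_pos by (simp add: qp hyperplane_angle_chord[OF p L om(1)] om(2) arcsin_sin)
  ultimately have "hyperplane_angle (q - p) (grad F q) = \<delta>"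
    using table p q unfolding gutkin_table_def by metis
  then have "arcsin \<bar>\<omega> \<bullet> N q\<bar> = \<delta>" by (simp add: qp hyperplane_angle_chord[OF q L om(1)])
  moreover have "\<bar>\<omega> \<bullet> N q\<bar> \<le> 1"
    using Cauchy_Schwarz_ineq2[of \<omega> "N q"] norm_normal[OF q] om(1)[folded norm_eq_1] by simp
  ultimately have "\<bar>\<omega> \<bullet> N q\<bar> = sn" using sin_arcsin[of "\<bar>\<omega> \<bullet> N q\<bar>"] by auto
  moreover have "grad F q \<bullet> \<omega> > 0"
    using exit_transversal[OF dir_enters(1)[OF v] len_pos[OF v]] tip_surf[OF v]
    by (simp add: q_def \<omega>_def tip_def)
  then have "N q \<bullet> \<omega> > 0" by (simp add: normal_inner[OF q] zero_less_mult_iff)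
  ultimately have "N q \<bullet> \<omega> = sn" by (simp add: inner_commute)
  then show "N (tip p v) \<bullet> dir p v = sn" "dir p v \<bullet> N (tip p v) = sn"
    by (auto simp: q_def \<omega>_def inner_commute)
qed

lemma normal_tip: "N (tip p v) = sn *\<^sub>R dir p v - cs *\<^sub>R \<mu> p v"
  using cs_pos by (simp add: \<mu>_def)

lemma \<mu>_inner:
  assumes v: "unit_tangent p v"
  shows "\<mu> p v \<bullet> dir p v = 0" "dir p v \<bullet> \<mu> p v = 0" "\<mu> p v \<bullet> \<mu> p v = 1"
proof -
  show *: "\<mu> p v \<bullet> dir p v = 0" "dir p v \<bullet> \<mu> p v = 0"
    using tip_normal[OF v] dir_inner[OF v] by (auto simp: \<mu>_def inner_diff_left inner_diff_right)
  have "N (tip p v) \<bullet> N (tip p v) = 1" using normal_inner_normal[OF tip_surf[OF v]] .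
  then have "sn * sn + cs * cs * (\<mu> p v \<bullet> \<mu> p v) = 1"
    unfolding normal_tip using * dir_inner[OF v] by (simp add: inner_diff_left inner_diff_right)
  then have "cs * cs * (\<mu> p v \<bullet> \<mu> p v) = cs * cs * 1" using sn_cs by linarith
  then show "\<mu> p v \<bullet> \<mu> p v = 1" using cs_pos by simp
qed

text \<open>With this the reversed chord belongs to the same family, based at the tip, so every
  statement about the foot of a chord can be applied at its other end.\<close>

lemma rev_dir_unit_tangent:
  assumes v: "unit_tangent p v"
  shows "unit_tangent (tip p v) (rev_dir p v)"
proof -
  have n: "N (tip p v) \<bullet> N (tip p v) = 1" using normal_inner_normal[OF tip_surf[OF v]] .
  have "rev_dir p v \<bullet> rev_dir p v = (1 - sn * sn) / (cs * cs)"
    using tip_normal[OF v] dir_inner[OF v] n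
    by (simp add: rev_dir_def inner_diff_left inner_diff_right divide_inverse algebra_simps)
  also have "\<dots> = 1" using sn_cs cs_pos by (simp add: field_simps)
  finally show ?thesis
    using tip_normal[OF v] n tip_surf[OF v] by (simp add: unit_tangent_def rev_dir_def inner_diff_left)
qed

lemma dir_rev_dir: "dir (tip p v) (rev_dir p v) = - dir p v"
  using cs_pos by (simp add: dir_def[of "tip p v"] rev_dir_def)

lemma len_rev_dir:
  assumes v: "unit_tangent p v"
  shows "len (tip p v) (rev_dir p v) = len p v"
  unfolding len_def[of "tip p v"]
proof (rule exit_time_eqI)
  show "enters (tip p v) (dir (tip p v) (rev_dir p v))" using dir_enters(1)[OF rev_dir_unit_tangent[OF v]] .
  show "len p v > 0" using len_pos[OF v] .
  show "tip p v + len p v *\<^sub>R dir (tip p v) (rev_dir p v) \<in> surf F"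
    using unit_tangentD(1)[OF v] by (simp add: dir_rev_dir) (simp add: tip_def)
qed

lemma tip_rev_dir:
  assumes v: "unit_tangent p v"
  shows "tip (tip p v) (rev_dir p v) = p"
  unfolding tip_def[of "tip p v"] len_rev_dir[OF v] dir_rev_dir by (simp add: tip_def)

text \<open>The exit time formula for the moving ray; its denominator is the constant
  \<open>sn\<close> by the angle condition at the tip. Rotation about a fixed foot and motion of the
  foot are both special cases.\<close>

lemma chord_derivatives:
  fixes \<gamma> V :: "real \<Rightarrow> 'a"
  assumes ut: "\<And>t. unit_tangent (\<gamma> t) (V t)"
    and d\<gamma>: "(\<gamma> has_vector_derivative u) (at t0)" and dV: "(V has_vector_derivative V') (at t0)"
  defines "L' \<equiv> - (N (tip (\<gamma> t0) (V t0)) \<bullet> (u + len (\<gamma> t0) (V t0) *\<^sub>R (cs *\<^sub>R V' - sn *\<^sub>R A (\<gamma> t0) u))) / sn"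
  shows len_derivative: "((\<lambda>t. len (\<gamma> t) (V t)) has_real_derivative L') (at t0)"
    and tip_derivative: "((\<lambda>t. tip (\<gamma> t) (V t)) has_vector_derivative
       (u + len (\<gamma> t0) (V t0) *\<^sub>R (cs *\<^sub>R V' - sn *\<^sub>R A (\<gamma> t0) u) + L' *\<^sub>R dir (\<gamma> t0) (V t0))) (at t0)"
proof -
  have S: "\<And>t. \<gamma> t \<in> surf F" using ut unit_tangentD by blast
  have dd: "((\<lambda>t. dir (\<gamma> t) (V t)) has_vector_derivative (cs *\<^sub>R V' - sn *\<^sub>R A (\<gamma> t0) u)) (at t0)"
    unfolding dir_def using normal_curve_derivative[OF S d\<gamma>] dV by (auto intro!: derivative_eq_intros)
  show *: "((\<lambda>t. len (\<gamma> t) (V t)) has_real_derivative L') (at t0)"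
    using exit_time_derivative[OF dir_enters[OF ut] d\<gamma> dd] tip_normal[OF ut]
    by (simp add: L'_def len_def tip_def)
  show "((\<lambda>t. tip (\<gamma> t) (V t)) has_vector_derivative
       (u + len (\<gamma> t0) (V t0) *\<^sub>R (cs *\<^sub>R V' - sn *\<^sub>R A (\<gamma> t0) u) + L' *\<^sub>R dir (\<gamma> t0) (V t0))) (at t0)"
    unfolding tip_def using d\<gamma> dd * by (auto intro!: derivative_eq_intros)
qed

end

section \<open>Chords of a Gutkin table\<close>

context gutkin
begin

text \<open>For tangent \<open>u\<close> at \<open>p\<close>, \<open>- cs * (X p v \<bullet> u)\<close> is the derivative in direction \<open>u\<close> of the angle
  defect of the chord at \<open>p\<close>; the normal component is chosen so that \<open>X\<close> is orthogonal to the chord.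
  Along a geodesic, \<open>ratio\<close> is the speed of the end point of the chord.\<close>

definition X :: "'a \<Rightarrow> 'a \<Rightarrow> 'a" where
  "X p v = len p v *\<^sub>R A p v - sn *\<^sub>R v + (cs * (len p v * (A p v \<bullet> v) - sn) / sn) *\<^sub>R N p"

definition ratio :: "'a \<Rightarrow> 'a \<Rightarrow> real" where
  "ratio p v = - (X p v \<bullet> \<mu> p v)"

lemma X_inner_tangent: "u \<bullet> N p = 0 \<Longrightarrow> X p v \<bullet> u = (len p v *\<^sub>R A p v - sn *\<^sub>R v) \<bullet> u"
  by (simp add: X_def inner_add_left inner_commute[of "N p"])

lemma X_inner_dir:
  assumes v: "unit_tangent p v"
  shows "X p v \<bullet> dir p v = 0"
proof -
  have "A p v \<bullet> dir p v = cs * (A p v \<bullet> v)"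
    using shape_tangent[OF unit_tangentD(1)[OF v]] by (simp add: dir_def inner_diff_right)
  then show ?thesis
    using dir_inner[OF v] sn_pos by (simp add: X_def inner_add_left inner_diff_left field_simps)
qed

text \<open>The left side is the right side of \<open>constant_angle_variation\<close> for this
  chord. Symmetry of the shape operator moves it from \<open>u\<close> to \<open>v\<close>,
  exhibiting the dependence on \<open>u\<close> through a single vector.\<close>

lemma X_gradient:
  assumes v: "unit_tangent p v" and u: "u \<bullet> N p = 0"
  shows "sn * (dir p v \<bullet> u) - len p v * (A p u \<bullet> dir p v) = - cs * (X p v \<bullet> u)"
proof -
  have p: "p \<in> surf F" and vN: "v \<bullet> N p = 0" using unit_tangentD[OF v] by auto
  have "A p u \<bullet> dir p v = cs * (A p v \<bullet> u)"
    using shape_tangent[OF p] shape_symmetric[OF p u vN] by (simp add: dir_def inner_diff_right)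
  then show ?thesis
    unfolding X_inner_tangent[OF u] dir_inner_tangent[OF u] by (simp add: inner_diff_left algebra_simps)
qed

lemma chord_angles:
  assumes v: "unit_tangent p v"
  shows "N p \<bullet> (p - tip p v) = sn * norm (p - tip p v)"
    and "N (tip p v) \<bullet> (tip p v - p) = sn * norm (tip p v - p)"
proof -
  have "norm (dir p v) = 1" using dir_inner[OF v] by (simp add: norm_eq_1)
  then show "N p \<bullet> (p - tip p v) = sn * norm (p - tip p v)"
    using dir_inner[OF v] len_pos[OF v] by (simp add: tip_def)
  show "N (tip p v) \<bullet> (tip p v - p) = sn * norm (tip p v - p)"
    using \<open>norm (dir p v) = 1\<close> tip_normal[OF v] len_pos[OF v] by (simp add: tip_def)
qed

text \<open>The angle condition at one end implies the one at the other, so their linearisations at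
  a chord are proportional; \<open>ratio\<close> is the factor. Since \<open>X\<close> is orthogonal
  to the chord, only directions orthogonal to both the chord and \<open>\<mu>\<close> remain to be
  excluded.\<close>

lemma X_eq:
  assumes v: "unit_tangent p v"
  shows "X p v = - ratio p v *\<^sub>R \<mu> p v"
proof -
  define q L \<omega> b where "q = tip p v" and "L = len p v" and "\<omega> = dir p v" and "b = rev_dir p v"
  have p: "p \<in> surf F" using unit_tangentD[OF v] by blast
  have L: "L > 0" using len_pos[OF v] by (simp add: L_def)
  have b: "unit_tangent q b" "tip q b = p" "len q b = L" "dir q b = - \<omega>"
    using rev_dir_unit_tangent[OF v] tip_rev_dir[OF v] len_rev_dir[OF v] dir_rev_dir
    by (auto simp: q_def b_def L_def \<omega>_def)
  \<comment> \<open>Rotating the reversed chord about its foot \<open>q\<close> keeps the angle at \<open>q\<close>, hence the angle at the other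
    end; so \<open>X\<close> is orthogonal to everything orthogonal to the chord and to \<open>\<mu>\<close>.\<close>
  have unit: "X p v \<bullet> w = 0" if w: "w \<bullet> w = 1" "w \<bullet> \<omega> = 0" "w \<bullet> \<mu> p v = 0" for w
  proof -
    have wN: "w \<bullet> N q = 0" using w normal_tip[of p v] by (simp add: q_def \<omega>_def inner_diff_right)
    then have "unit_tangent q w" using w b(1) by (simp add: unit_tangent_def)
    moreover have "w \<bullet> b = 0" using w wN
      by (simp add: b_def rev_dir_def q_def \<omega>_def inner_diff_right)
    then have "b \<bullet> w = 0" by (simp add: inner_commute)
    ultimately have ut: "unit_tangent q (cos t *\<^sub>R b + sin t *\<^sub>R w)" for t
      using unit_tangent_rotate[OF b(1)] by blast
    define P where "P t = tip q (cos t *\<^sub>R b + sin t *\<^sub>R w)" for t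
    have P0: "P 0 = p" using b by (simp add: P_def)
    have "((\<lambda>t. cos t *\<^sub>R b + sin t *\<^sub>R w) has_vector_derivative w) (at 0)"
      by (auto intro!: derivative_eq_intros)
    note dtip = tip_derivative[of "\<lambda>_. q", OF ut has_vector_derivative_const this]
    define l where "l = - (N p \<bullet> (L *\<^sub>R cs *\<^sub>R w)) / sn"
    have dP: "(P has_vector_derivative (L * cs) *\<^sub>R w - l *\<^sub>R \<omega>) (at 0)"
      using dtip b linear_0[OF linear_shape[OF unit_tangentD(1)[OF b(1)]]]
      by (simp add: P_def[abs_def] l_def)
    define u where "u = (L * cs) *\<^sub>R w - l *\<^sub>R \<omega>"
    have PS: "P t \<in> surf F" for t using tip_surf[OF ut] by (simp add: P_def)
    have uN: "u \<bullet> N p = 0" using surface_curve_tangent[OF PS dP] P0 by (simp add: u_def inner_commute)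
    \<comment> \<open>The foot \<open>q\<close> is fixed, so its velocity is 0; the moving point
      \<open>P\<close> satisfies the angle condition by the table property.\<close>
    have "(sn *\<^sub>R \<omega> + N (P 0)) \<bullet> 0 = sn * (\<omega> \<bullet> u) - L * (A (P 0) u \<bullet> \<omega>)"
    proof (rule constant_angle_variation[OF PS dP[folded u_def] has_vector_derivative_const[of q]])
      show "N (P t) \<bullet> (P t - q) = sn * norm (P t - q)" for t
        using chord_angles(2)[OF ut] by (simp add: P_def)
    qed (use sn_pos L dir_inner[OF v] P0 in \<open>auto simp: q_def tip_def L_def \<omega>_def\<close>)
    then have "X p v \<bullet> u = 0"
      using X_gradient[OF v uN] P0 cs_pos by (simp add: \<omega>_def L_def)
    moreover have "X p v \<bullet> u = L * cs * (X p v \<bullet> w)"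
      using X_inner_dir[OF v] by (simp add: u_def inner_diff_right \<omega>_def)
    ultimately show ?thesis using L cs_pos by simp
  qed
  have orth: "X p v \<bullet> w = 0" if w: "w \<bullet> \<omega> = 0" "w \<bullet> \<mu> p v = 0" for w
  proof (cases "w = 0")
    case False
    have "(w /\<^sub>R norm w) \<bullet> (w /\<^sub>R norm w) = 1"
      using False by (simp flip: power2_norm_eq_inner)
    then have "X p v \<bullet> (w /\<^sub>R norm w) = 0" using w by (intro unit) auto
    then show ?thesis using False by simp
  qed simp
  \<comment> \<open>\<open>w\<close> is the part of \<open>X p v\<close> orthogonal to
    \<open>\<mu> p v\<close>. It is orthogonal to the chord too, hence to \<open>X p v\<close>,
    hence to itself.\<close>
  define w where "w = X p v + ratio p v *\<^sub>R \<mu> p v"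
  have w\<mu>: "w \<bullet> \<mu> p v = 0" using \<mu>_inner[OF v] by (simp add: w_def ratio_def inner_add_left inner_diff_left)
  have "w \<bullet> \<omega> = 0" using \<mu>_inner[OF v] X_inner_dir[OF v] by (simp add: w_def \<omega>_def inner_add_left)
  then have "X p v \<bullet> w = 0" using orth w\<mu> by blast
  then have "w \<bullet> w = 0" using w\<mu> by (simp add: w_def inner_add_left inner_commute)
  then show ?thesis by (simp add: w_def eq_neg_iff_add_eq_0)
qed

text \<open>The squared length of \<open>X\<close> computed twice: from its orthogonal tangential
  and normal parts, and as the square of the factor of the unit vector \<open>\<mu>\<close>.\<close>

lemma ratio_squared:
  assumes v: "unit_tangent p v"
  shows "(ratio p v)\<^sup>2 = (len p v)\<^sup>2 * (A p v \<bullet> A p v) - 2 * sn * len p v * (A p v \<bullet> v) + sn\<^sup>2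
           + cs\<^sup>2 * (len p v * (A p v \<bullet> v) - sn)\<^sup>2 / sn\<^sup>2"
proof -
  define y where "y = len p v *\<^sub>R A p v - sn *\<^sub>R v"
  define h where "h = cs * (len p v * (A p v \<bullet> v) - sn) / sn"
  have "y \<bullet> N p = 0"
    using shape_tangent[OF unit_tangentD(1)[OF v]] unit_tangentD[OF v] by (simp add: y_def inner_diff_left)
  then have "X p v \<bullet> X p v = y \<bullet> y + h\<^sup>2"
    using unit_tangentD(5)[OF v]
    by (simp add: X_def y_def[symmetric] h_def[symmetric] inner_add_left inner_add_right inner_commute[of "N p" y] power2_eq_square)
  moreover have "X p v \<bullet> X p v = (ratio p v)\<^sup>2"
    using \<mu>_inner[OF v] by (simp add: X_eq[OF v] power2_eq_square)
  moreover have "y \<bullet> y = (len p v)\<^sup>2 * (A p v \<bullet> A p v) - 2 * sn * len p v * (A p v \<bullet> v) + sn\<^sup>2"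
    using unit_tangentD(2)[OF v]
    by (simp add: y_def inner_diff_left inner_diff_right inner_commute power2_eq_square algebra_simps)
  ultimately show ?thesis by (simp add: h_def power_divide power_mult_distrib)
qed

text \<open>The dimension bound enters here: \<open>N p\<close>, \<open>x\<close> and
  \<open>y\<close> span at most three dimensions, leaving a common orthogonal direction.\<close>

lemma exists_orthogonal_unit_tangent:
  assumes "p \<in> surf F"
  obtains w where "unit_tangent p w" "w \<bullet> x = 0" "w \<bullet> y = 0"
proof -
  have "dim {N p, x, y} \<le> card {N p, x, y}" by (rule dim_le_card') simp
  also have "\<dots> \<le> 3" by (simp add: card_insert_le_m1)
  finally have "dim {N p, x, y} < DIM('a)" using dim by simp
  then obtain z where z: "z \<noteq> 0" "\<And>b. b \<in> span {N p, x, y} \<Longrightarrow> orthogonal z b"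
    using orthogonal_to_subspace_exists by blast
  have "z \<bullet> N p = 0" "z \<bullet> x = 0" "z \<bullet> y = 0"
    using z(2) by (auto simp: orthogonal_def intro!: span_base)
  moreover have "(z /\<^sub>R norm z) \<bullet> (z /\<^sub>R norm z) = 1"
    using z(1) by (simp flip: power2_norm_eq_inner)
  ultimately show thesis
    using assms by (intro that[of "z /\<^sub>R norm z"]) (auto simp: unit_tangent_def)
qed

text \<open>If \<open>ratio\<close> vanishes, so does \<open>X\<close>. Moving the foot along the
  tangential part \<open>u\<close> of \<open>\<mu>\<close> then satisfies both linearised angle
  conditions only if \<open>\<mu>\<close> is orthogonal to \<open>u\<close>, that is, normal to the
  hypersurface at \<open>p\<close>. But \<open>\<mu>\<close> is orthogonal to the chord and the
  normal is not.\<close>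

lemma ratio_nonzero:
  assumes v: "unit_tangent p v"
  shows "ratio p v \<noteq> 0"
proof
  assume r0: "ratio p v = 0"
  have p: "p \<in> surf F" using unit_tangentD[OF v] by blast
  define u where "u = \<mu> p v - (\<mu> p v \<bullet> N p) *\<^sub>R N p"
  have uN: "u \<bullet> N p = 0" using unit_tangentD[OF v] by (simp add: u_def inner_diff_left)
  obtain \<gamma> where \<gamma>: "\<And>t. \<gamma> t \<in> surf F" "\<gamma> 0 = p" "(\<gamma> has_vector_derivative u) (at (0::real))"
    using surface_curve[OF p uN] by blast
  obtain V where V: "\<And>t. unit_tangent (\<gamma> t) (V t)" "V 0 = v"
    "(V has_vector_derivative - (v \<bullet> A (\<gamma> 0) u) *\<^sub>R N (\<gamma> 0)) (at 0)"
    using transport[OF \<gamma>(1) \<gamma>(3)] v \<gamma>(2) exists_orthogonal_unit_tangent[OF \<gamma>(1)] by metis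
  define Q where "Q t = tip (\<gamma> t) (V t)" for t
  have QS: "Q t \<in> surf F" for t using tip_surf[OF V(1)] by (simp add: Q_def)
  obtain q' where dQ: "(Q has_vector_derivative q') (at 0)"
    using tip_derivative[OF V(1) \<gamma>(3) V(3)] unfolding Q_def by blast
  define q b where "q = tip p v" and "b = rev_dir p v"
  have Q0: "Q 0 = q" using \<gamma> V by (simp add: Q_def q_def)
  have q'N: "q' \<bullet> N q = 0" using surface_curve_tangent[OF QS dQ] Q0 by (simp add: inner_commute)
  have b: "unit_tangent q b" "tip q b = p" "len q b = len p v" "dir q b = - dir p v"
    using rev_dir_unit_tangent[OF v] tip_rev_dir[OF v] len_rev_dir[OF v] dir_rev_dir
    by (auto simp: q_def b_def)
  have "(sn *\<^sub>R dir p v + N (\<gamma> 0)) \<bullet> q' = sn * (dir p v \<bullet> u) - len p v * (A (\<gamma> 0) u \<bullet> dir p v)"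
    by (rule constant_angle_variation[OF \<gamma>(1,3) dQ])
      (use chord_angles(1)[OF V(1)] sn_pos len_pos[OF v] dir_inner[OF v] \<gamma>(2) Q0 in \<open>auto simp: Q_def q_def tip_def\<close>)
  then have 1: "(sn *\<^sub>R dir p v + N p) \<bullet> q' = 0"
    using X_gradient[OF v uN] X_eq[OF v] r0 \<gamma>(2) by simp
  have "(sn *\<^sub>R dir q b + N (Q 0)) \<bullet> u = sn * (dir q b \<bullet> q') - len q b * (A (Q 0) q' \<bullet> dir q b)"
    by (rule constant_angle_variation[OF QS dQ \<gamma>(3)])
      (use chord_angles(2)[OF V(1)] sn_pos len_pos[OF v] dir_inner[OF v] \<gamma>(2) Q0 b in \<open>auto simp: Q_def q_def tip_def\<close>)
  also have "\<dots> = cs * ratio q b * (\<mu> q b \<bullet> q')"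
    unfolding Q0 X_gradient[OF b(1) q'N] using X_eq[OF b(1)] by simp
  \<comment> \<open>The reversed chord ends at \<open>p\<close>, so \<open>\<mu> q b\<close> is a
    multiple of \<open>sn *\<^sub>R dir p v + N p\<close>, which fact \<open>1\<close> makes
    orthogonal to \<open>q'\<close>.\<close>
  also have "\<dots> = 0"
    using 1 b by (simp add: \<mu>_def inner_diff_left inner_add_left)
  finally have "(sn *\<^sub>R dir p v - N q) \<bullet> u = 0"
    by (simp add: b Q0 inner_diff_left inner_add_left)
  then have "\<mu> p v \<bullet> u = 0" using cs_pos by (simp add: \<mu>_def q_def)
  then have m: "(\<mu> p v \<bullet> N p)\<^sup>2 = 1"
    using \<mu>_inner[OF v] by (simp add: u_def inner_diff_right power2_eq_square)
  \<comment> \<open>\<open>z\<close> is the component of \<open>N p\<close> orthogonal to the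
    orthonormal pair \<open>\<mu> p v\<close>, \<open>dir p v\<close>; Bessel's inequality leaves no
    room for \<open>sn\<close>.\<close>
  define z where "z = N p - (\<mu> p v \<bullet> N p) *\<^sub>R \<mu> p v + sn *\<^sub>R dir p v"
  have "z \<bullet> z = 1 - (\<mu> p v \<bullet> N p)\<^sup>2 - sn\<^sup>2"
    using \<mu>_inner[OF v] dir_inner[OF v] unit_tangentD(5)[OF v]
    by (simp add: z_def inner_diff_left inner_diff_right inner_add_left inner_add_right inner_commute[of "N p" "\<mu> p v"] power2_eq_square algebra_simps)
  moreover have "z \<bullet> z \<ge> 0" by simp
  ultimately show False using m sn_pos by (smt (verit) zero_less_power)
qed

text \<open>Rotating the chord about its foot changes the length through
  \<open>\<mu> \<bullet> W\<close>. The identity for \<open>X\<close> turns this into the shape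
  operator divided by \<open>ratio\<close>, which is nonzero.\<close>

lemma len_fibre_derivative:
  assumes v: "unit_tangent p e1" "unit_tangent p e2" "e1 \<bullet> e2 = 0"
  defines "V \<equiv> \<lambda>t. cos t *\<^sub>R e1 + sin t *\<^sub>R e2" and "W \<equiv> \<lambda>t. cos t *\<^sub>R e2 - sin t *\<^sub>R e1"
  shows "((\<lambda>t. len p (V t)) has_real_derivative
           - (cs\<^sup>2 / sn) * (len p (V t))\<^sup>2 * (A p (V t) \<bullet> W t) / ratio p (V t)) (at t)"
    and "isCont (\<lambda>t. tip p (V t)) t"
proof -
  have ut: "unit_tangent p (V t)" for t using unit_tangent_rotate[OF v] by (simp add: V_def)
  have p: "p \<in> surf F" using unit_tangentD[OF ut] by blast
  have dV: "(V has_vector_derivative W t) (at t)"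
    unfolding V_def W_def by (auto intro!: derivative_eq_intros simp: algebra_simps)
  have A0: "A p 0 = 0" using linear_0[OF linear_shape[OF p]] .
  have WN: "W t \<bullet> N p = 0" using v by (simp add: W_def inner_diff_left unit_tangent_def)
  have VW: "V t \<bullet> W t = 0"
    using v by (simp add: V_def W_def inner_add_left inner_diff_right inner_commute[of e2 e1] unit_tangent_def)
  have "((\<lambda>t. len p (V t)) has_real_derivative - (N (tip p (V t)) \<bullet> (len p (V t) *\<^sub>R (cs *\<^sub>R W t))) / sn) (at t)"
    using len_derivative[of "\<lambda>_. p", OF ut has_vector_derivative_const dV] A0 by simp
  moreover have "N (tip p (V t)) \<bullet> W t = - cs * (\<mu> p (V t) \<bullet> W t)"
    using dir_inner_tangent[OF WN] VW by (simp add: normal_tip inner_diff_left)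
  moreover have "ratio p (V t) * (\<mu> p (V t) \<bullet> W t) = - len p (V t) * (A p (V t) \<bullet> W t)"
  proof -
    have "- ratio p (V t) * (\<mu> p (V t) \<bullet> W t) = X p (V t) \<bullet> W t" by (simp add: X_eq[OF ut])
    also have "\<dots> = len p (V t) * (A p (V t) \<bullet> W t)"
      using VW by (simp add: X_inner_tangent[OF WN] inner_diff_left)
    finally show ?thesis by simp
  qed
  then have "\<mu> p (V t) \<bullet> W t = - len p (V t) * (A p (V t) \<bullet> W t) / ratio p (V t)"
    using ratio_nonzero[OF ut] by (simp add: field_simps)
  ultimately show "((\<lambda>t. len p (V t)) has_real_derivative
           - (cs\<^sup>2 / sn) * (len p (V t))\<^sup>2 * (A p (V t) \<bullet> W t) / ratio p (V t)) (at t)"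
    by (simp add: power2_eq_square mult_ac)
  show "isCont (\<lambda>t. tip p (V t)) t"
    using tip_derivative[of "\<lambda>_. p", OF ut has_vector_derivative_const dV] has_vector_derivative_continuous
    by blast
qed

text \<open>The hypotheses are the first-order data of a geodesic with velocity
  \<open>\<sigma> *\<^sub>R V\<close> at \<open>t0\<close>. The factor \<sigma> allows the same
  curve to be used with \<open>V\<close>, with \<open>- V\<close>, and when it is at rest.\<close>

lemma len_geodesic_derivative:
  assumes ut: "\<And>t. unit_tangent (\<gamma> t) (V t)"
    and d\<gamma>: "(\<gamma> has_vector_derivative \<sigma> *\<^sub>R V t0) (at t0)"
    and dV: "(V has_vector_derivative - (\<sigma> * (A (\<gamma> t0) (V t0) \<bullet> V t0)) *\<^sub>R N (\<gamma> t0)) (at t0)"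
  shows "((\<lambda>t. len (\<gamma> t) (V t)) has_real_derivative \<sigma> * cs * (ratio (\<gamma> t0) (V t0) - 1)) (at t0)"
proof -
  define p v L k where "p = \<gamma> t0" and "v = V t0" and "L = len p v" and "k = A p v \<bullet> v"
  have v: "unit_tangent p v" using ut by (simp add: p_def v_def)
  have p: "p \<in> surf F" using unit_tangentD[OF v] by blast
  have A\<sigma>: "A p (\<sigma> *\<^sub>R v) = \<sigma> *\<^sub>R A p v" using linear_scale[OF linear_shape[OF p]] .
  \<comment> \<open>\<open>\<sigma> *\<^sub>R Y\<close> is the velocity of the tip without the
    contribution of the changing length. In the basis of chord and \<open>\<mu>\<close> it has
    coefficients \<open>cs\<close> and \<open>sn * ratio p v\<close>, up to \<sigma>.\<close>
  define Y where "Y = v - (L * cs * k) *\<^sub>R N p - (L * sn) *\<^sub>R A p v"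
  define h where "h = cs * (L * k - sn) / sn"
  have h: "sn * h = cs * (L * k - sn)" using sn_pos by (simp add: h_def)
  have "cs *\<^sub>R dir p v - sn *\<^sub>R X p v
      = (sn * sn + cs * cs) *\<^sub>R v - (cs * sn + sn * h) *\<^sub>R N p - (L * sn) *\<^sub>R A p v"
    unfolding X_def dir_def L_def[symmetric] k_def[symmetric] h_def[symmetric]
    by (simp add: scaleR_diff_right scaleR_add_right scaleR_add_left mult.commute)
  also have "\<dots> = Y" unfolding sn_cs h by (simp add: Y_def algebra_simps)
  finally have Y: "Y = cs *\<^sub>R dir p v + (sn * ratio p v) *\<^sub>R \<mu> p v" by (simp add: X_eq[OF v])
  have NY: "N (tip p v) \<bullet> Y = sn * cs * (1 - ratio p v)"
    unfolding Y normal_tip using \<mu>_inner[OF v] dir_inner[OF v]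
    by (simp add: inner_diff_left inner_add_right algebra_simps)
  have eqY: "\<sigma> *\<^sub>R v + L *\<^sub>R (cs *\<^sub>R (- (\<sigma> * k) *\<^sub>R N p) - sn *\<^sub>R A p (\<sigma> *\<^sub>R v)) = \<sigma> *\<^sub>R Y"
    by (simp add: A\<sigma> Y_def algebra_simps)
  have "- (N (tip p v) \<bullet> (\<sigma> *\<^sub>R v + L *\<^sub>R (cs *\<^sub>R (- (\<sigma> * k) *\<^sub>R N p) - sn *\<^sub>R A p (\<sigma> *\<^sub>R v)))) / sn
      = \<sigma> * cs * (ratio p v - 1)"
    unfolding eqY inner_scaleR_right NY using sn_pos by (simp add: field_simps)
  then show ?thesis
    using len_derivative[OF ut d\<gamma> dV]
    unfolding p_def[symmetric] v_def[symmetric] L_def[symmetric] k_def[symmetric] by simp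
qed

end

section \<open>Evenness of the chord length\<close>

lemma continuous_nonzero_same_sign:
  fixes f :: "real \<Rightarrow> real"
  assumes "continuous_on UNIV f" "\<And>x. f x \<noteq> 0"
  shows "f x * f y > 0"
proof (rule ccontr)
  assume "\<not> ?thesis"
  then have "(f x \<le> 0 \<and> 0 \<le> f y) \<or> (f y \<le> 0 \<and> 0 \<le> f x)"
    using assms(2) by (metis linorder_not_le mult_neg_neg mult_pos_pos less_imp_le)
  moreover have "connected (range f)" using assms(1) connected_continuous_image by blast
  ultimately have "0 \<in> range f" using connectedD_interval by blast
  then show False using assms(2) by auto
qed

context gutkin
begin

lemma shape_linear_simps:
  assumes "p \<in> surf F"
  shows "A p (x + y) = A p x + A p y" "A p (x - y) = A p x - A p y" "A p (a *\<^sub>R x) = a *\<^sub>R A p x"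
    "A p (- x) = - A p x"
  using linear_shape[OF assms] by (auto simp: linear_add linear_diff linear_scale linear_neg)

text \<open>Along a great circle of directions, \<open>L1\<close> and its half-turn shift
  \<open>L2\<close> solve equations with the same coefficients. The difference \<open>D\<close> then
  satisfies a linear homogeneous equation with continuous coefficient \<open>h\<close>, so one zero
  of \<open>D\<close> makes it vanish identically.\<close>

lemma len_ratio_even:
  assumes v: "unit_tangent p v"
  shows "len p (- v) = len p v" "ratio p (- v) = ratio p v"
proof -
  have p: "p \<in> surf F" using unit_tangentD[OF v] by blast
  obtain w where w: "unit_tangent p w" "w \<bullet> v = 0"
    using exists_orthogonal_unit_tangent[OF p] by blast
  have vw: "v \<bullet> w = 0" using w by (simp add: inner_commute)
  define V W where "V t = cos t *\<^sub>R v + sin t *\<^sub>R w" and "W t = cos t *\<^sub>R w - sin t *\<^sub>R v" for t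
  define L1 L2 r1 r2 where "L1 t = len p (V t)" and "L2 t = L1 (t + pi)"
    and "r1 t = ratio p (V t)" and "r2 t = r1 (t + pi)" for t
  define a where "a t = A p (V t) \<bullet> W t" for t
  have ut: "unit_tangent p (V t)" for t using unit_tangent_rotate[OF v w(1) vw] by (simp add: V_def)
  have Vpi: "V (t + pi) = - V t" "W (t + pi) = - W t" for t by (simp_all add: V_def W_def)
  have api: "a (t + pi) = a t" for t by (simp add: a_def Vpi shape_linear_simps[OF p])
  have dL1: "(L1 has_real_derivative - (cs\<^sup>2 / sn) * (L1 t)\<^sup>2 * a t / r1 t) (at t)" for t
    using len_fibre_derivative(1)[OF v w(1) vw] unfolding L1_def r1_def a_def V_def W_def .
  have dL2: "(L2 has_real_derivative - (cs\<^sup>2 / sn) * (L2 t)\<^sup>2 * a t / r2 t) (at t)" for t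
    using dL1[of "t + pi"] unfolding L2_def r2_def api DERIV_shift .
  have cV: "isCont V t" "isCont W t" for t unfolding V_def W_def by (auto intro!: continuous_intros)
  have cA: "isCont (\<lambda>t. A p (V t)) t" for t
    using bounded_linear.isCont[OF bounded_linear_shape[OF p] cV(1)] .
  have cL1: "isCont L1 t" for t using dL1 DERIV_isCont by blast
  have cr1: "isCont r1 t" for t
  proof -
    have "isCont (\<lambda>t. tip p (V t)) t"
      using len_fibre_derivative(2)[OF v w(1) vw] unfolding V_def .
    then have "isCont (\<lambda>t. N (tip p (V t))) t"
      by (rule isCont_o2) (rule isCont_normal[OF tip_surf[OF ut]])
    then have "isCont (\<lambda>t. \<mu> p (V t)) t"
      unfolding \<mu>_def dir_def using cV by (intro continuous_intros) (auto simp: cs_pos less_imp_neq)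
    moreover have "isCont (\<lambda>t. X p (V t)) t"
      unfolding X_def L1_def[symmetric] using cV cA cL1 sn_pos by (intro continuous_intros) auto
    ultimately show ?thesis unfolding r1_def ratio_def by (intro continuous_intros)
  qed
  have shift: "isCont (\<lambda>t. t + pi) t" for t :: real by (intro continuous_intros)
  have cL2: "isCont L2 t" and cr2: "isCont r2 t" for t
    unfolding L2_def r2_def using isCont_o2[OF shift] cL1 cr1 by blast+
  have r0: "r1 t \<noteq> 0" "r2 t \<noteq> 0" for t using ratio_nonzero[OF ut] by (auto simp: r1_def r2_def)
  \<comment> \<open>A continuous function without zeros keeps its sign. This makes
    \<open>r1 t + r2 t\<close> a legitimate divisor and later picks the right square root.\<close>
  have rpos: "r1 t * r2 t > 0" for t
    unfolding r2_def using cr1 r0(1)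
    by (intro continuous_nonzero_same_sign) (auto intro: continuous_at_imp_continuous_on)
  have rsum: "r1 t + r2 t \<noteq> 0" for t
    using rpos[of t] by (metis add.inverse_inverse add_eq_0_iff mult_minus_right not_square_less_zero neg_0_less_iff_less)
  define k B where "k t = A p (V t) \<bullet> V t" and "B t = A p (V t) \<bullet> A p (V t)" for t
  have R1: "(r1 t)\<^sup>2 = (L1 t)\<^sup>2 * B t - 2 * sn * L1 t * k t + sn\<^sup>2 + cs\<^sup>2 * (L1 t * k t - sn)\<^sup>2 / sn\<^sup>2" for t
    using ratio_squared[OF ut] unfolding r1_def L1_def B_def k_def .
  have Bk: "B (t + pi) = B t" "k (t + pi) = k t" for t
    by (simp_all add: B_def k_def Vpi shape_linear_simps[OF p])
  have R2: "(r2 t)\<^sup>2 = (L2 t)\<^sup>2 * B t - 2 * sn * L2 t * k t + sn\<^sup>2 + cs\<^sup>2 * (L2 t * k t - sn)\<^sup>2 / sn\<^sup>2" for t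
    using R1[of "t + pi"] unfolding Bk r2_def L2_def .
  define D where "D t = L1 t - L2 t" for t
  \<comment> \<open>\<open>ratio_squared\<close> is quadratic in the length with coefficients
    unchanged by \<open>v \<mapsto> - v\<close>; \<open>Q\<close> is the cofactor of
    \<open>L1 t - L2 t\<close> in the difference of its two instances.\<close>
  define Q where "Q t = (L1 t + L2 t) * (B t + cs\<^sup>2 * (k t)\<^sup>2 / sn\<^sup>2) - 2 * sn * k t - 2 * cs\<^sup>2 * k t / sn" for t
  have RQ: "(r1 t)\<^sup>2 - (r2 t)\<^sup>2 = D t * Q t" for t
    unfolding R1 R2 D_def Q_def using sn_pos by (simp add: field_simps power2_eq_square)
  define h where "h t = - (cs\<^sup>2 / sn) * a t * ((L1 t + L2 t) / r1 t - (L2 t)\<^sup>2 * Q t / (r1 t * r2 t * (r1 t + r2 t)))" for t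
  have dD: "(D has_real_derivative h t * D t) (at t)" for t
  proof -
    have "1 / r1 t - 1 / r2 t = - (D t * Q t) / (r1 t * r2 t * (r1 t + r2 t))"
      unfolding RQ[symmetric] using r0 rsum by (simp add: divide_simps) (simp add: power2_eq_square algebra_simps)
    moreover have "(L1 t)\<^sup>2 / r1 t - (L2 t)\<^sup>2 / r2 t
        = (L1 t + L2 t) / r1 t * D t + (L2 t)\<^sup>2 * (1 / r1 t - 1 / r2 t)"
      unfolding D_def using r0 by (simp add: field_simps power2_eq_square)
    ultimately have "(L1 t)\<^sup>2 / r1 t - (L2 t)\<^sup>2 / r2 t
        = ((L1 t + L2 t) / r1 t - (L2 t)\<^sup>2 * Q t / (r1 t * r2 t * (r1 t + r2 t))) * D t"
      by (simp add: left_diff_distrib)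
    then have "- (cs\<^sup>2 / sn) * a t * ((L1 t)\<^sup>2 / r1 t - (L2 t)\<^sup>2 / r2 t) = h t * D t"
      unfolding h_def by simp
    moreover have "(D has_real_derivative - (cs\<^sup>2 / sn) * (L1 t)\<^sup>2 * a t / r1 t - (- (cs\<^sup>2 / sn) * (L2 t)\<^sup>2 * a t / r2 t)) (at t)"
      unfolding D_def by (intro derivative_intros dL1 dL2)
    moreover have "- (cs\<^sup>2 / sn) * (L1 t)\<^sup>2 * a t / r1 t - (- (cs\<^sup>2 / sn) * (L2 t)\<^sup>2 * a t / r2 t)
        = - (cs\<^sup>2 / sn) * a t * ((L1 t)\<^sup>2 / r1 t - (L2 t)\<^sup>2 / r2 t)"
      by (simp add: algebra_simps)
    ultimately show ?thesis by simp
  qed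
  have ch: "continuous_on UNIV h"
  proof (intro continuous_at_imp_continuous_on ballI)
    fix t
    have "isCont a t" "isCont B t" "isCont k t"
      unfolding a_def B_def k_def using cA cV by (auto intro!: continuous_intros)
    then show "isCont h t"
      unfolding h_def Q_def using cL1 cL2 cr1 cr2 r0 rsum sn_pos by (intro continuous_intros) auto
  qed
  have "\<exists>t. D t = 0"
  proof -
    \<comment> \<open>\<open>L2 pi\<close> is the length after a full turn, so \<open>D\<close>
      changes sign over half a turn.\<close>
    have "D pi = - D 0" by (simp add: D_def L2_def L1_def V_def)
    then have "(D 0 \<le> 0 \<and> 0 \<le> D pi) \<or> (D pi \<le> 0 \<and> 0 \<le> D 0)" by linarith
    moreover have "continuous_on UNIV D"
      using dD DERIV_isCont continuous_at_imp_continuous_on by blast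
    then have "connected (range D)" using connected_continuous_image by blast
    ultimately have "0 \<in> range D" using connectedD_interval by blast
    then show ?thesis by auto
  qed
  then have D0: "D 0 = 0" using linear_ode_zero[OF dD ch] by blast
  have V0: "V 0 = v" "V pi = - v" by (simp_all add: V_def)
  show "len p (- v) = len p v" using D0 by (simp add: D_def L1_def L2_def V0)
  have "(r1 0)\<^sup>2 = (r2 0)\<^sup>2" using RQ[of 0] D0 by simp
  then have "r1 0 = r2 0"
    using rpos[of 0] by (metis mult_minus_right not_square_less_zero neg_0_less_iff_less power2_eq_iff)
  then show "ratio p (- v) = ratio p v" by (simp add: r1_def r2_def V0)
qed

text \<open>Evenness makes \<open>len (\<gamma> t) (V t)\<close> and
  \<open>len (\<gamma> t) (- V t)\<close> one function. Its derivative, computed with \<sigma> equal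
  to 1 and to -1, comes out with opposite signs.\<close>

lemma ratio_one:
  assumes v: "unit_tangent p v"
  shows "ratio p v = 1"
proof -
  have p: "p \<in> surf F" and vN: "v \<bullet> N p = 0" using unit_tangentD[OF v] by auto
  obtain \<gamma> where \<gamma>: "\<And>t. \<gamma> t \<in> surf F" "\<gamma> 0 = p" "(\<gamma> has_vector_derivative v) (at (0::real))"
    using surface_curve[OF p vN] by blast
  obtain V where V: "\<And>t. unit_tangent (\<gamma> t) (V t)" "V 0 = v"
    "(V has_vector_derivative - (v \<bullet> A (\<gamma> 0) v) *\<^sub>R N (\<gamma> 0)) (at 0)"
    using transport[OF \<gamma>(1) \<gamma>(3)] v \<gamma>(2) exists_orthogonal_unit_tangent[OF \<gamma>(1)] by metis
  have "((\<lambda>t. len (\<gamma> t) (V t)) has_real_derivative 1 * cs * (ratio (\<gamma> 0) (V 0) - 1)) (at 0)"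
    by (rule len_geodesic_derivative[OF V(1)]) (use \<gamma> V in \<open>auto simp: inner_commute\<close>)
  moreover have "((\<lambda>t. len (\<gamma> t) (- V t)) has_real_derivative (- 1) * cs * (ratio (\<gamma> 0) (- V 0) - 1)) (at 0)"
  proof (rule len_geodesic_derivative[OF unit_tangent_minus[OF V(1)]])
    show "(\<gamma> has_vector_derivative (- 1) *\<^sub>R (- V 0)) (at 0)" using \<gamma> V by simp
    have "((\<lambda>t. - V t) has_vector_derivative - (- (v \<bullet> A (\<gamma> 0) v) *\<^sub>R N (\<gamma> 0))) (at 0)"
      using V(3) by (rule has_vector_derivative_minus)
    then show "((\<lambda>t. - V t) has_vector_derivative
       - (- 1 * (A (\<gamma> 0) (- V 0) \<bullet> - V 0)) *\<^sub>R N (\<gamma> 0)) (at 0)"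
      by (simp add: V(2) shape_linear_simps[OF \<gamma>(1)] inner_commute)
  qed
  moreover have "(\<lambda>t. len (\<gamma> t) (- V t)) = (\<lambda>t. len (\<gamma> t) (V t))"
    using len_ratio_even(1)[OF V(1)] by blast
  ultimately have "1 * cs * (ratio (\<gamma> 0) (V 0) - 1) = (- 1) * cs * (ratio (\<gamma> 0) (- V 0) - 1)"
    using DERIV_unique by metis
  then have "cs * (ratio p v - 1) = 0"
    using len_ratio_even(2)[OF v] \<gamma> V by simp
  then show ?thesis using cs_pos by simp
qed

section \<open>From constant ratio to umbilic points\<close>

text \<open>With \<open>ratio\<close> equal to 1 the rotation equation for \<open>1 / len\<close> is
  \<open>cs\<^sup>2 / (2 * sn)\<close> times that for the normal curvature, so the difference is a
  first integral, compared at a quarter turn.\<close>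

lemma curvature_len_orthogonal:
  assumes v: "unit_tangent p v" and w: "unit_tangent p w" and vw: "v \<bullet> w = 0"
  shows "1 / len p v - cs\<^sup>2 / (2 * sn) * (A p v \<bullet> v) = 1 / len p w - cs\<^sup>2 / (2 * sn) * (A p w \<bullet> w)"
proof -
  define V W where "V t = cos t *\<^sub>R v + sin t *\<^sub>R w" and "W t = cos t *\<^sub>R w - sin t *\<^sub>R v" for t
  have ut: "unit_tangent p (V t)" for t using unit_tangent_rotate[OF v w vw] by (simp add: V_def)
  have p: "p \<in> surf F" using unit_tangentD[OF v] by blast
  define m where "m t = 1 / len p (V t) - cs\<^sup>2 / (2 * sn) * (A p (V t) \<bullet> V t)" for t
  have "(m has_real_derivative 0) (at t)" for t
  proof -
    have dL: "((\<lambda>t. len p (V t)) has_real_derivative - (cs\<^sup>2 / sn) * (len p (V t))\<^sup>2 * (A p (V t) \<bullet> W t)) (at t)"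
      using len_fibre_derivative(1)[OF v w vw, of t] ratio_one[OF ut] unfolding V_def W_def by simp
    have dV: "(V has_vector_derivative W t) (at t)"
      unfolding V_def W_def by (auto intro!: derivative_eq_intros simp: algebra_simps)
    have dA: "((\<lambda>t. A p (V t)) has_vector_derivative A p (W t)) (at t)"
      using bounded_linear.has_vector_derivative[OF bounded_linear_shape[OF p] dV] .
    have "((\<lambda>t. A p (V t) \<bullet> V t) has_derivative (\<lambda>h. A p (V t) \<bullet> (h *\<^sub>R W t) + (h *\<^sub>R A p (W t)) \<bullet> V t)) (at t)"
      using has_derivative_inner[OF dA[unfolded has_vector_derivative_def] dV[unfolded has_vector_derivative_def]] .
    moreover have "A p (W t) \<bullet> V t = A p (V t) \<bullet> W t"
      using v w by (intro shape_symmetric[OF p]) (auto simp: V_def W_def unit_tangent_def inner_diff_left inner_add_left)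
    ultimately have dk: "((\<lambda>t. A p (V t) \<bullet> V t) has_real_derivative 2 * (A p (V t) \<bullet> W t)) (at t)"
      unfolding has_field_derivative_def by (elim has_derivative_eq_rhs) (auto simp: fun_eq_iff)
    have "((\<lambda>t. 1 / len p (V t)) has_real_derivative cs\<^sup>2 / sn * (A p (V t) \<bullet> W t)) (at t)"
      by (rule derivative_eq_intros dL refl)+
        (use len_pos[OF ut, of t] in \<open>auto simp: field_simps power2_eq_square\<close>)
    from DERIV_diff[OF this DERIV_cmult[OF dk, of "cs\<^sup>2 / (2 * sn)"]]
    show ?thesis unfolding m_def by simp
  qed
  then have "m 0 = m (pi / 2)" using DERIV_isconst_all by blast
  then show ?thesis by (simp add: m_def V_def)
qed

text \<open>The first integral eliminates the length from \<open>ratio_squared\<close>, leaving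
  \<open>A p v \<bullet> A p v = \<kappa> * (A p v \<bullet> v)\<close>. Polarised, this says that
  \<open>A p\<close> composed with \<open>A p\<close> minus \<kappa> vanishes on the tangent space;
  positive principal curvatures make \<open>A p\<close> injective there.\<close>

lemma umbilic:
  assumes p: "p \<in> surf F"
  shows "\<exists>\<kappa>>0. (\<forall>v. v \<bullet> N p = 0 \<longrightarrow> A p v = \<kappa> *\<^sub>R v) \<and> (\<forall>v. unit_tangent p v \<longrightarrow> len p v = 2 * sn / \<kappa>)"
proof -
  obtain e where e: "unit_tangent p e" using exists_orthogonal_unit_tangent[OF p] by blast
  define m where "m = 1 / len p e - cs\<^sup>2 / (2 * sn) * (A p e \<bullet> e)"
  have m: "1 / len p v = m + cs\<^sup>2 / (2 * sn) * (A p v \<bullet> v)" if v: "unit_tangent p v" for v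
  proof -
    \<comment> \<open>Any two directions are compared through a third one orthogonal to
      both.\<close>
    obtain w where w: "unit_tangent p w" "w \<bullet> e = 0" "w \<bullet> v = 0"
      using exists_orthogonal_unit_tangent[OF p] by blast
    show ?thesis
      using curvature_len_orthogonal[OF w(1) e w(2)] curvature_len_orthogonal[OF w(1) v w(3)]
      unfolding m_def by linarith
  qed
  define \<kappa> where "\<kappa> = 2 * m / sn"
  have quad: "sn\<^sup>2 * (A p v \<bullet> A p v) + cs\<^sup>2 * (A p v \<bullet> v)\<^sup>2 = 2 * sn * (A p v \<bullet> v) * (1 / len p v)" if v: "unit_tangent p v" for v
  proof -
    define L k B where "L = len p v" and "k = A p v \<bullet> v" and "B = A p v \<bullet> A p v"
    have L: "L > 0" using len_pos[OF v] by (simp add: L_def)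
    have "1 = L\<^sup>2 * B - 2 * sn * L * k + sn\<^sup>2 + cs\<^sup>2 * (L * k - sn)\<^sup>2 / sn\<^sup>2"
      using ratio_squared[OF v] ratio_one[OF v] by (simp add: L_def k_def B_def)
    then have "sn\<^sup>2 = sn\<^sup>2 * L\<^sup>2 * B - 2 * sn * sn\<^sup>2 * L * k + sn\<^sup>2 * sn\<^sup>2 + cs\<^sup>2 * (L * k - sn)\<^sup>2"
      using sn_pos by (simp add: field_simps)
    then have "L * (L * (sn\<^sup>2 * B + cs\<^sup>2 * k\<^sup>2)) = L * (2 * sn * k)"
      unfolding cos_squared_eq by (simp add: power2_eq_square algebra_simps)
    then have "L * (sn\<^sup>2 * B + cs\<^sup>2 * k\<^sup>2) = 2 * sn * k" using L by simp
    then show ?thesis unfolding L_def[symmetric] k_def[symmetric] B_def[symmetric] using L by (simp add: field_simps)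
  qed
  have unit: "A p v \<bullet> A p v = \<kappa> * (A p v \<bullet> v)" if v: "unit_tangent p v" for v
    using quad[OF v] sn_pos unfolding m[OF v] \<kappa>_def by (simp add: field_simps power2_eq_square)
  have all: "A p x \<bullet> A p x = \<kappa> * (A p x \<bullet> x)" if x: "x \<bullet> N p = 0" for x
  proof (cases "x = 0")
    case True then show ?thesis by (simp add: linear_0[OF linear_shape[OF p]])
  next
    case False
    have "unit_tangent p (x /\<^sub>R norm x)"
      using False x p by (simp add: unit_tangent_def flip: power2_norm_eq_inner)
    from unit[OF this] show ?thesis
      using False by (simp add: shape_linear_simps[OF p])
  qed
  have pol: "A p x \<bullet> A p y = \<kappa> * (A p x \<bullet> y)" if x: "x \<bullet> N p = 0" and y: "y \<bullet> N p = 0" for x y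
  proof -
    have "(x + y) \<bullet> N p = 0" using x y by (simp add: inner_add_left)
    from all[OF this] all[OF x] all[OF y] show ?thesis
      using shape_symmetric[OF p x y]
      by (simp add: shape_linear_simps[OF p] inner_add_left inner_add_right inner_commute[of "A p y" "A p x"] algebra_simps)
  qed
  have principal: "\<kappa>' > 0" if "z \<bullet> N p = 0" "z \<noteq> 0" "A p z = \<kappa>' *\<^sub>R z" for z \<kappa>'
  proof -
    have "principal_pair F p \<kappa>' z"
      using that normal_inner[OF p] by (simp add: principal_pair_def tangent_space_def inner_commute)
    then show ?thesis using table p unfolding gutkin_table_def by blast
  qed
  have scalar: "A p y = \<kappa> *\<^sub>R y" if y: "y \<bullet> N p = 0" for y
  proof -
    \<comment> \<open>A nonzero \<open>z\<close> would be a principal direction with curvature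
      0.\<close>
    define z where "z = A p y - \<kappa> *\<^sub>R y"
    have zN: "z \<bullet> N p = 0" using y shape_tangent[OF p] by (simp add: z_def inner_diff_left)
    have "A p z \<bullet> x = 0" if x: "x \<bullet> N p = 0" for x
      using pol[OF x y] shape_symmetric[OF p zN x] by (simp add: z_def[symmetric] inner_diff_right) (simp add: z_def inner_diff_right)
    then have "A p z \<bullet> A p z = 0" using shape_tangent[OF p] by blast
    then have "A p z = 0 *\<^sub>R z" by simp
    then have "z = 0" using principal[OF zN] by (metis less_irrefl)
    then show ?thesis by (simp add: z_def)
  qed
  have "e \<noteq> 0" using unit_tangentD(2)[OF e] by auto
  then have \<kappa>: "\<kappa> > 0" using principal scalar unit_tangentD(3)[OF e] by blast
  have "len p v = 2 * sn / \<kappa>" if v: "unit_tangent p v" for v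
  proof -
    have A: "A p v = \<kappa> *\<^sub>R v" using scalar unit_tangentD(3)[OF v] by blast
    have "sn\<^sup>2 * \<kappa>\<^sup>2 + cs\<^sup>2 * \<kappa>\<^sup>2 = 2 * sn * \<kappa> * (1 / len p v)"
      using quad[OF v] unit_tangentD(2)[OF v] by (simp add: A power2_eq_square)
    moreover have "sn\<^sup>2 * \<kappa>\<^sup>2 + cs\<^sup>2 * \<kappa>\<^sup>2 = \<kappa>\<^sup>2" by (simp flip: distrib_right)
    ultimately have "\<kappa>\<^sup>2 = 2 * sn * \<kappa> * (1 / len p v)" by simp
    then show ?thesis using \<kappa> len_pos[OF v] by (simp add: field_simps power2_eq_square)
  qed
  then show ?thesis using \<kappa> scalar by blast
qed

end

section \<open>Umbilicity and the round sphere\<close>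

text \<open>Applied later to the fact that a line meets a round sphere at most twice.\<close>

lemma quadratic_three_roots:
  fixes a b e :: real
  assumes "a * t\<^sup>2 + b * t + e = 0" "a * s\<^sup>2 + b * s + e = 0" "a * u\<^sup>2 + b * u + e = 0"
    and "t \<noteq> s" "s \<noteq> u" "t \<noteq> u"
  shows "a = 0"
proof -
  have "(t - s) * (a * (t + s) + b) = 0" "(t - u) * (a * (t + u) + b) = 0"
    using assms(1-3) by (auto simp: algebra_simps power2_eq_square)
  then have "a * (t + s) + b = 0" "a * (t + u) + b = 0" using assms(4,6) by simp_all
  then have "a * (t + s) = a * (t + u)" by linarith
  then show ?thesis using assms(5) by simp
qed

context gutkin
begin

text \<open>Constancy of \<open>K\<close> comes from the chord length \<open>2 * sn / K\<close>,
  whose derivative along the curve vanishes because \<open>ratio\<close> is 1. Then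
  \<open>N - K \<gamma>\<close> has derivative zero, since \<open>A\<close> is multiplication by
  \<open>K\<close>.\<close>

lemma curve_umbilic_constant:
  assumes \<gamma>S: "\<And>t. \<gamma> t \<in> surf F" and d\<gamma>: "\<And>t. \<gamma> differentiable (at (t::real))"
    and K: "\<And>p v. p \<in> surf F \<Longrightarrow> v \<bullet> N p = 0 \<Longrightarrow> A p v = K p *\<^sub>R v" "\<And>p. p \<in> surf F \<Longrightarrow> K p > 0"
      "\<And>p v. unit_tangent p v \<Longrightarrow> len p v = 2 * sn / K p"
  shows "K (\<gamma> s) = K (\<gamma> t)" "N (\<gamma> s) - K (\<gamma> s) *\<^sub>R \<gamma> s = N (\<gamma> t) - K (\<gamma> t) *\<^sub>R \<gamma> t"
proof -
  define \<gamma>' where "\<gamma>' t = vector_derivative \<gamma> (at t)" for t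
  have \<gamma>': "(\<gamma> has_vector_derivative \<gamma>' t) (at t)" for t
    using d\<gamma> by (simp add: \<gamma>'_def vector_derivative_works)
  have \<gamma>'N: "\<gamma>' t \<bullet> N (\<gamma> t) = 0" for t
    using surface_curve_tangent[OF \<gamma>S \<gamma>'] by (simp add: inner_commute)
  have "((\<lambda>t. K (\<gamma> t)) has_real_derivative 0) (at t)" for t
  proof -
    \<comment> \<open>Where the curve is at rest, any unit tangent vector with factor 0
      does.\<close>
    obtain \<sigma> v where v: "unit_tangent (\<gamma> t) v" "\<gamma>' t = \<sigma> *\<^sub>R v"
    proof (cases "\<gamma>' t = 0")
      case True
      then show thesis using exists_orthogonal_unit_tangent[OF \<gamma>S] that[of _ 0] by (metis scaleR_zero_left)
    next
      case False
      then show thesis using \<gamma>'N \<gamma>S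
        by (intro that[of "\<gamma>' t /\<^sub>R norm (\<gamma>' t)" "norm (\<gamma>' t)"])
          (simp_all add: unit_tangent_def flip: power2_norm_eq_inner)
    qed
    obtain V where V: "\<And>t. unit_tangent (\<gamma> t) (V t)" "V t = v"
      "(V has_vector_derivative - (v \<bullet> A (\<gamma> t) (\<sigma> *\<^sub>R v)) *\<^sub>R N (\<gamma> t)) (at t)"
      using transport[OF \<gamma>S \<gamma>' v(1)] v(2) exists_orthogonal_unit_tangent[OF \<gamma>S] by metis
    have "((\<lambda>t. len (\<gamma> t) (V t)) has_real_derivative \<sigma> * cs * (ratio (\<gamma> t) (V t) - 1)) (at t)"
      by (rule len_geodesic_derivative[OF V(1)])
        (use \<gamma>'[of t] V v in \<open>auto simp: shape_linear_simps[OF \<gamma>S] inner_commute\<close>)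
    then have "((\<lambda>t. len (\<gamma> t) (V t)) has_real_derivative 0) (at t)" by (simp add: ratio_one[OF V(1)])
    then have "((\<lambda>t. 2 * sn / len (\<gamma> t) (V t)) has_real_derivative 0) (at t)"
      using len_pos[OF V(1)[of t]] by (auto intro!: derivative_eq_intros)
    moreover have "2 * sn / len (\<gamma> t) (V t) = K (\<gamma> t)" for t
      using K(3)[OF V(1)[of t]] K(2)[OF \<gamma>S[of t]] sn_pos by simp
    ultimately show ?thesis by simp
  qed
  then show const: "K (\<gamma> s) = K (\<gamma> t)" for s t using DERIV_isconst_all by blast
  define f where "f u = N (\<gamma> u) - K (\<gamma> s) *\<^sub>R \<gamma> u" for u
  have "(f has_vector_derivative 0) (at u)" for u
  proof -
    have "A (\<gamma> u) (\<gamma>' u) = K (\<gamma> s) *\<^sub>R \<gamma>' u" using K(1)[OF \<gamma>S \<gamma>'N] const by metis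
    moreover have "((\<lambda>u. K (\<gamma> s) *\<^sub>R \<gamma> u) has_vector_derivative K (\<gamma> s) *\<^sub>R \<gamma>' u) (at u)"
      using bounded_linear.has_vector_derivative[OF bounded_linear_scaleR_right \<gamma>'] .
    ultimately show ?thesis unfolding f_def
      using has_vector_derivative_diff[OF normal_curve_derivative[OF \<gamma>S \<gamma>'[of u]]] by fastforce
  qed
  then obtain c where "\<And>u. f u = c"
    using has_vector_derivative_zero_constant[of UNIV f] by auto
  then have "f s = f t" by simp
  then show "N (\<gamma> s) - K (\<gamma> s) *\<^sub>R \<gamma> s = N (\<gamma> t) - K (\<gamma> t) *\<^sub>R \<gamma> t"
    using const[of t s] by (simp add: f_def)
qed

text \<open>Any point is joined to \<open>p0\<close> by a projected path, so curvature and centre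
  agree everywhere and \<open>surf F\<close> lies on a sphere. Rays from an interior point show that
  the sphere is filled out.\<close>

theorem round_sphere:
  obtains C r where "r > 0" "surf F = sphere C r" "\<And>x. x \<in> surf F \<Longrightarrow> N x = (x - C) /\<^sub>R r"
proof -
  have "\<forall>p\<in>surf F. \<exists>\<kappa>>0. (\<forall>v. v \<bullet> N p = 0 \<longrightarrow> A p v = \<kappa> *\<^sub>R v) \<and> (\<forall>v. unit_tangent p v \<longrightarrow> len p v = 2 * sn / \<kappa>)"
    using umbilic by blast
  then obtain K where "\<forall>p\<in>surf F. 0 < K p \<and> (\<forall>v. v \<bullet> N p = 0 \<longrightarrow> A p v = K p *\<^sub>R v) \<and> (\<forall>v. unit_tangent p v \<longrightarrow> len p v = 2 * sn / K p)"
    by (elim bchoice[THEN exE]) auto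
  then have K: "\<And>p v. p \<in> surf F \<Longrightarrow> v \<bullet> N p = 0 \<Longrightarrow> A p v = K p *\<^sub>R v" "\<And>p. p \<in> surf F \<Longrightarrow> K p > 0"
      "\<And>p v. unit_tangent p v \<Longrightarrow> len p v = 2 * sn / K p"
    using unit_tangentD(1) by auto
  obtain x0 where x0: "F x0 < 0" using negative_point by blast
  obtain p0 where p0: "p0 \<in> surf F" using surf_nonempty by blast
  have same: "K p = K p0" "N p - K p *\<^sub>R p = N p0 - K p0 *\<^sub>R p0" if p: "p \<in> surf F" for p
  proof -
    obtain z where z: "unit_tangent p0 z" "z \<bullet> (p0 - x0) = 0" "z \<bullet> (p - x0) = 0"
      using exists_orthogonal_unit_tangent[OF p0] by blast
    \<comment> \<open>The detour along \<open>z\<close> keeps the path away from the centre of the radial projection.\<close>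
    define x where "x t = p0 + t *\<^sub>R (p - p0) + (t * (1 - t)) *\<^sub>R z" for t :: real
    have ne: "x t \<noteq> x0" for t
    proof
      assume "x t = x0"
      moreover have "x t - x0 = (1 - t) *\<^sub>R (p0 - x0) + t *\<^sub>R (p - x0) + (t * (1 - t)) *\<^sub>R z"
        by (simp add: x_def algebra_simps)
      moreover from calculation have "z \<bullet> ((1 - t) *\<^sub>R (p0 - x0) + t *\<^sub>R (p - x0) + (t * (1 - t)) *\<^sub>R z) = 0"
        by (metis eq_iff_diff_eq_0 inner_zero_right)
      then have "t * (1 - t) = 0" using z unit_tangentD(2)[OF z(1)] by (simp add: inner_add_right)
      then have "t = 0 \<or> t = 1" by simp
      ultimately show False using x0 p p0 by (auto simp: x_def surf_def)
    qed
    have dx: "x differentiable (at t)" for t unfolding x_def by (intro derivative_intros)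
    define \<gamma> where "\<gamma> t = x0 + exit_time x0 (x t - x0) *\<^sub>R (x t - x0)" for t
    have "\<gamma> t \<in> surf F" "\<gamma> differentiable (at t)" for t
      using radial_curve(1,2)[OF x0 ne dx] unfolding \<gamma>_def by auto
    from curve_umbilic_constant[OF this K, of 1 0] show "K p = K p0" "N p - K p *\<^sub>R p = N p0 - K p0 *\<^sub>R p0"
      using radial_curve(3)[OF x0 ne dx, of 0] radial_curve(3)[OF x0 ne dx, of 1] p p0
      by (auto simp: \<gamma>_def x_def)
  qed
  define r C where "r = 1 / K p0" and "C = p0 - r *\<^sub>R N p0"
  have r: "r > 0" using K(2)[OF p0] by (simp add: r_def)
  have NC: "N p = (p - C) /\<^sub>R r" if p: "p \<in> surf F" for p
  proof -
    have "N p - K p0 *\<^sub>R p = N p0 - K p0 *\<^sub>R p0" using same[OF p] by simp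
    then have "N p = K p0 *\<^sub>R (p - C)"
      using K(2)[OF p0] by (simp add: C_def r_def algebra_simps)
    then show ?thesis by (simp add: r_def)
  qed
  have sub: "norm (p - C) = r" if p: "p \<in> surf F" for p
    using norm_normal[OF p] r unfolding NC[OF p] by (simp add: inverse_eq_divide)
  \<comment> \<open>The exit point of the opposite ray, at parameter \<open>- u\<close>, is a third
    sphere point on the line, so \<open>\<tau>\<close> must coincide with \<open>t\<close>.\<close>
  have line: "\<tau> = t" if d: "d \<noteq> 0" and t: "norm (x0 + \<tau> *\<^sub>R d - C) = r" "\<tau> \<ge> 0"
    "t > 0" "x0 + t *\<^sub>R d \<in> surf F" for d \<tau> t
  proof (rule ccontr)
    assume "\<tau> \<noteq> t"
    define u where "u = exit_time x0 (- d)"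
    have u: "u > 0" "x0 + u *\<^sub>R (- d) \<in> surf F"
      using exit_time[OF enters_interior[OF x0], of "- d"] d by (auto simp: u_def)
    have q: "(d \<bullet> d) * \<rho>\<^sup>2 + (2 * ((x0 - C) \<bullet> d)) * \<rho> + ((x0 - C) \<bullet> (x0 - C) - r\<^sup>2) = 0"
      if "norm (x0 + \<rho> *\<^sub>R d - C) = r" for \<rho>
    proof -
      have "(x0 - C + \<rho> *\<^sub>R d) \<bullet> (x0 - C + \<rho> *\<^sub>R d) = r\<^sup>2"
      proof -
        have "x0 - C + \<rho> *\<^sub>R d = x0 + \<rho> *\<^sub>R d - C" by simp
        then show ?thesis using that unfolding power2_norm_eq_inner[symmetric] by (simp only:)
      qed
      moreover define z where "z = x0 - C"
      moreover have "(z + \<rho> *\<^sub>R d) \<bullet> (z + \<rho> *\<^sub>R d) = (d \<bullet> d) * \<rho>\<^sup>2 + (2 * (z \<bullet> d)) * \<rho> + z \<bullet> z"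
        by (simp add: inner_add_left inner_add_right inner_commute[of d z] power2_eq_square distrib_left)
      ultimately show ?thesis by (simp only: add_diff_eq diff_self)
    qed
    have "d \<bullet> d = 0"
      by (rule quadratic_three_roots[OF q[OF t(1)] q[of t] q[of "- u"]])
        (use u t sub \<open>\<tau> \<noteq> t\<close> in auto)
    then show False using d by simp
  qed
  have "y \<in> surf F" if y: "norm (y - C) = r" for y
  proof (cases "y = x0")
    \<comment> \<open>If the sphere contained \<open>x0\<close> itself, any ray from
      \<open>x0\<close> would have exit time 0, contradicting positivity.\<close>
    case True
    define d where "d = N p0"
    have d: "d \<noteq> 0" using norm_normal[OF p0] by (auto simp: d_def)
    have "0 = exit_time x0 d"
      by (rule line[OF d]) (use exit_time[OF enters_interior[OF x0] d] y True in auto)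
    then show ?thesis using exit_time_pos[OF enters_interior[OF x0] d] by simp
  next
    case False
    then have d: "y - x0 \<noteq> 0" by simp
    have "1 = exit_time x0 (y - x0)"
      by (rule line[OF d]) (use exit_time[OF enters_interior[OF x0] d] y in auto)
    then show ?thesis using exit_time_surf[OF enters_interior[OF x0] d] by simp
  qed
  then have "surf F = sphere C r" using sub by (auto simp: dist_norm norm_minus_commute)
  then show thesis using that r NC by blast
qed

end

section \<open>Round spheres\<close>

lemma Ck_const: "Ck k (\<lambda>x::'a::euclidean_space. c)"
proof (induction k arbitrary: c)
  case (Suc k)
  then show ?case by (simp add: frechet_derivative_const)
qed simp

lemma Ck_inner: "Ck k (\<lambda>x::'a::euclidean_space. x \<bullet> v)"
proof (cases k)
  case (Suc j)
  have d: "((\<lambda>x. x \<bullet> v) has_derivative (\<lambda>h. h \<bullet> v)) (at x)" for x :: 'a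
    by (auto intro!: derivative_eq_intros)
  have "frechet_derivative (\<lambda>x. x \<bullet> v) (at x) = (\<lambda>h. h \<bullet> v)" for x :: 'a
    using frechet_derivative_at[OF d] by simp
  then show ?thesis using d Suc Ck_const by (auto simp: differentiable_def)
qed (auto intro!: continuous_intros)

lemma Ck_norm_squared: "Ck k (\<lambda>x::'a::euclidean_space. x \<bullet> x - c)"
proof (cases k)
  case (Suc j)
  have d: "((\<lambda>x. x \<bullet> x - c) has_derivative (\<lambda>h. x \<bullet> (2 *\<^sub>R h))) (at x)" for x :: 'a
    by (auto intro!: derivative_eq_intros simp: inner_commute)
  have "frechet_derivative (\<lambda>x. x \<bullet> x - c) (at x) = (\<lambda>h. x \<bullet> (2 *\<^sub>R h))" for x :: 'a
    using frechet_derivative_at[OF d] by simp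
  then show ?thesis using d Suc Ck_inner[of j "2 *\<^sub>R _"] by (auto simp: differentiable_def simp del: inner_scaleR_right)
qed (auto intro!: continuous_intros)

lemma grad_norm_squared: "grad (\<lambda>x::'a::euclidean_space. x \<bullet> x - c) x = 2 *\<^sub>R x"
proof -
  have d: "((\<lambda>x. x \<bullet> x - c) has_derivative (\<lambda>h. 2 * (x \<bullet> h))) (at x)"
    by (auto intro!: derivative_eq_intros simp: inner_commute)
  have "grad (\<lambda>x::'a. x \<bullet> x - c) x = (\<Sum>b\<in>Basis. (2 * (x \<bullet> b)) *\<^sub>R b)"
    unfolding grad_def frechet_derivative_at[OF d, symmetric] ..
  also have "\<dots> = 2 *\<^sub>R (\<Sum>b\<in>Basis. (x \<bullet> b) *\<^sub>R b)" by (simp add: scaleR_sum_right)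
  finally show ?thesis by (simp add: euclidean_representation)
qed

text \<open>Supplies the planar tables. The normal is \<open>x /\<^sub>R r\<close> only on the
  sphere itself, so the shape operator is found by differentiating along great circles. The angle
  condition holds since \<open>p \<bullet> p = q \<bullet> q\<close> makes the products of
  \<open>q - p\<close> with both normals opposite.\<close>

lemma round_sphere_gutkin_table:
  assumes r: "r > 0" and \<delta>: "0 < \<delta>" "\<delta> < pi / 2" and dim: "DIM('a::euclidean_space) \<ge> 2"
  shows "surf (\<lambda>x::'a. x \<bullet> x - r\<^sup>2) = sphere 0 r" "gutkin_table (\<lambda>x::'a. x \<bullet> x - r\<^sup>2) \<delta>"
proof -
  let ?G = "\<lambda>x::'a. x \<bullet> x - r\<^sup>2"
  show surf: "surf ?G = sphere 0 r"
    using r by (auto simp: surf_def simp flip: power2_norm_eq_inner)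
  have body: "body ?G = cball 0 r"
    using r by (auto simp: body_def abs_le_square_iff[symmetric] simp flip: power2_norm_eq_inner)
  have "convex_defining_function ?G"
    unfolding convex_defining_function_def body grad_norm_squared smooth_fun_def
    using r Ck_norm_squared by (auto simp: surf)
  then interpret convex_table ?G by unfold_locales
  have N: "unit_normal ?G x = x /\<^sub>R r" if "x \<in> surf ?G" for x
    using that r unfolding surf unit_normal_def grad_norm_squared by simp
  have "\<kappa> > 0" if p: "p \<in> surf ?G" and pp: "principal_pair ?G p \<kappa> v" for p \<kappa> v
  proof -
    have v: "p \<bullet> v = 0" "v \<noteq> 0" "A p v = \<kappa> *\<^sub>R v"
      using pp by (auto simp: principal_pair_def tangent_space_def grad_norm_squared)
    \<comment> \<open>Rescaling \<open>v\<close> to length \<open>r\<close> keeps the curve \<gamma>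
      on the sphere of radius \<open>r\<close>.\<close>
    define w where "w = (r / norm v) *\<^sub>R v"
    have w: "p \<bullet> w = 0" "norm w = r" using v r by (auto simp: w_def)
    define \<gamma> where "\<gamma> t = cos t *\<^sub>R p + sin t *\<^sub>R w" for t
    have pr: "p \<bullet> p = r\<^sup>2" "w \<bullet> w = r\<^sup>2"
      using p w by (auto simp: surf_def simp flip: power2_norm_eq_inner)
    have "\<gamma> t \<bullet> \<gamma> t = (cos t)\<^sup>2 * r\<^sup>2 + (sin t)\<^sup>2 * r\<^sup>2" for t
      using w pr by (simp add: \<gamma>_def inner_add_left inner_add_right inner_commute[of w p] power2_eq_square)
    then have "\<gamma> t \<bullet> \<gamma> t = r\<^sup>2" for t by (simp flip: distrib_right)
    then have \<gamma>S: "\<gamma> t \<in> surf ?G" for t by (simp add: surf_def)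
    have d\<gamma>: "(\<gamma> has_vector_derivative w) (at 0)" unfolding \<gamma>_def by (auto intro!: derivative_eq_intros)
    have "((\<lambda>t. \<gamma> t /\<^sub>R r) has_vector_derivative A (\<gamma> 0) w) (at 0)"
      using normal_curve_derivative[OF \<gamma>S d\<gamma>] N[OF \<gamma>S] by simp
    moreover have "((\<lambda>t. \<gamma> t /\<^sub>R r) has_vector_derivative w /\<^sub>R r) (at 0)"
      using bounded_linear.has_vector_derivative[OF bounded_linear_scaleR_right d\<gamma>] .
    ultimately have "A p w = w /\<^sub>R r" using vector_derivative_unique_at by (force simp: \<gamma>_def)
    then have "(r / norm v) *\<^sub>R (\<kappa> *\<^sub>R v) = (r / norm v) *\<^sub>R (v /\<^sub>R r)"
      using v linear_scale[OF linear_shape[OF p]] by (simp add: w_def)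
    then have "\<kappa> *\<^sub>R v = (1 / r) *\<^sub>R v" using r v by (simp add: divide_inverse)
    then show ?thesis using r v by simp
  qed
  moreover have "hyperplane_angle (q - p) (grad ?G q) = hyperplane_angle (q - p) (grad ?G p)"
    if "p \<in> surf ?G" "q \<in> surf ?G" for p q
  proof -
    have "p \<bullet> p = r\<^sup>2" "q \<bullet> q = r\<^sup>2" "norm p = norm q" using that by (auto simp: surf_def surf norm_eq)
    then show ?thesis
      by (simp add: hyperplane_angle_def grad_norm_squared inner_diff_left inner_commute[of q p] abs_minus_commute abs_mult)
  qed
  ultimately show "gutkin_table ?G \<delta>"
    unfolding gutkin_table_def using \<delta> dim defining by auto
qed

section \<open>Width, enclosed body and geodesics of a round sphere\<close>

lemma constant_width_cball:
  fixes C :: "'a::euclidean_space"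
  assumes r: "r > 0"
  shows "constant_width (cball C r)"
  unfolding constant_width_def
proof (intro exI allI impI)
  fix u :: 'a assume u: "norm u = 1"
  have uu: "u \<bullet> u = 1" using u by (simp add: norm_eq_1)
  have b: "\<bar>x \<bullet> u - C \<bullet> u\<bar> \<le> r" if "x \<in> cball C r" for x
    using Cauchy_Schwarz_ineq2[of "x - C" u] that u by (simp add: inner_diff_left dist_norm norm_minus_commute)
  have "(SUP x\<in>cball C r. x \<bullet> u) = C \<bullet> u + r"
  proof (rule cSup_eq_maximum)
    show "C \<bullet> u + r \<in> (\<lambda>x. x \<bullet> u) ` cball C r"
      using r u uu by (intro image_eqI[of _ _ "C + r *\<^sub>R u"]) (auto simp: inner_add_left dist_norm)
  qed (use b in \<open>force simp: abs_le_iff\<close>)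
  moreover have "(INF x\<in>cball C r. x \<bullet> u) = C \<bullet> u - r"
  proof (rule cInf_eq_minimum)
    show "C \<bullet> u - r \<in> (\<lambda>x. x \<bullet> u) ` cball C r"
      using r u uu by (intro image_eqI[of _ _ "C - r *\<^sub>R u"]) (auto simp: inner_diff_left dist_norm)
  qed (use b in \<open>force simp: abs_le_iff\<close>)
  ultimately show "width (cball C r) u = 2 * r" by (simp add: width_def)
qed

text \<open>A point with \<open>F < 0\<close> outside the open ball would send a ray away from
  \<open>C\<close> that meets \<open>surf F\<close> beyond the sphere. The open ball is connected,
  contains a negative point and no zero of \<open>F\<close>, so \<open>F\<close> is negative
  throughout it.\<close>

lemma (in convex_table) body_eq_cball:
  assumes S: "surf F = sphere C r" and r: "r > 0"
  shows "body F = cball C r"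
proof -
  have outside: "norm (y - C) < r" if y: "F y < 0" for y
  proof (rule ccontr)
    assume "\<not> ?thesis"
    then have yr: "norm (y - C) \<ge> r" by simp
    then have d: "y - C \<noteq> 0" using r by auto
    define t where "t = exit_time y (y - C)"
    have t: "t > 0" "y + t *\<^sub>R (y - C) \<in> surf F"
      using exit_time[OF enters_interior[OF y] d] by (auto simp: t_def)
    have "y + t *\<^sub>R (y - C) - C = (1 + t) *\<^sub>R (y - C)" by (simp add: algebra_simps)
    moreover have "norm (y + t *\<^sub>R (y - C) - C) = r"
      using t(2) unfolding S mem_sphere dist_norm norm_minus_commute[of C] .
    ultimately have "(1 + t) * norm (y - C) = r" using t(1) by simp
    moreover have "(1 + t) * norm (y - C) > 1 * norm (y - C)"
      using t d by (intro mult_strict_right_mono) auto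
    ultimately show False using yr by simp
  qed
  have inside: "F y < 0" if y: "norm (y - C) < r" for y
  proof (rule ccontr)
    assume "\<not> F y < 0"
    obtain x0 where x0: "F x0 < 0" using negative_point by blast
    have "connected (F ` ball C r)"
      using continuous_F by (intro connected_continuous_image) auto
    moreover have "F x0 \<in> F ` ball C r" "F y \<in> F ` ball C r"
      using outside[OF x0] y by (auto simp: dist_norm norm_minus_commute)
    ultimately have "0 \<in> F ` ball C r"
      using connectedD_interval[of "F ` ball C r" "F x0" "F y" 0] x0 \<open>\<not> F y < 0\<close> by simp
    then obtain z where "z \<in> ball C r" "z \<in> surf F" by (auto simp: surf_def)
    then show False by (simp add: S)
  qed
  show ?thesis
  proof (intro set_eqI iffI)
    fix x assume "x \<in> body F"
    then have "F x < 0 \<or> x \<in> sphere C r" unfolding S[symmetric] by (auto simp: body_def surf_def)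
    then show "x \<in> cball C r" using outside[of x] by (auto simp: dist_norm norm_minus_commute[of C] less_imp_le)
  next
    fix x assume "x \<in> cball C r"
    then have "norm (x - C) < r \<or> x \<in> surf F" unfolding S by (auto simp: dist_norm norm_minus_commute)
    then show "x \<in> body F" using inside by (auto simp: body_def surf_def less_imp_le)
  qed
qed

text \<open>Along a geodesic of a round sphere \<open>\<gamma>'' = -\<alpha> (\<gamma> - C)\<close> with \<open>\<alpha>\<close> constant, so each
  coordinate of \<open>\<gamma> - C\<close> has a conserved energy.\<close>

lemma sphere_geodesic_planar:
  assumes geo: "geodesic F I \<gamma>" and S: "surf F = sphere C r" and r: "r > 0"
    and g: "\<And>x. x \<in> surf F \<Longrightarrow> \<exists>k. grad F x = k *\<^sub>R (x - C)"
  obtains u w where "orthonormal2 u w" "\<And>t. t \<in> I \<Longrightarrow> \<gamma> t \<in> range (plane_chart C u w)"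
proof -
  obtain \<gamma>' \<gamma>'' where I: "open I" "is_interval I" "I \<noteq> {}"
    and G: "\<And>t. t \<in> I \<Longrightarrow> \<gamma> t \<in> surf F" "\<And>t. t \<in> I \<Longrightarrow> (\<gamma> has_vector_derivative \<gamma>' t) (at t)"
      "\<And>t. t \<in> I \<Longrightarrow> (\<gamma>' has_vector_derivative \<gamma>'' t) (at t)" "\<And>t. t \<in> I \<Longrightarrow> \<gamma>' t \<noteq> 0"
      "\<And>t. t \<in> I \<Longrightarrow> \<exists>c. \<gamma>'' t = c *\<^sub>R grad F (\<gamma> t)"
    using geo unfolding geodesic_def by blast
  have conv: "convex I" using I(2) is_interval_convex by blast
  define y where "y t = \<gamma> t - C" for t
  have dy: "(y has_vector_derivative \<gamma>' t) (at t)" if "t \<in> I" for t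
    using G(2)[OF that] unfolding y_def by (auto intro!: derivative_eq_intros)
  have yy: "y t \<bullet> y t = r\<^sup>2" if "t \<in> I" for t
    using G(1)[OF that] by (simp add: S y_def dist_norm norm_minus_commute flip: power2_norm_eq_inner)
  have dinner: "((\<lambda>t. f t \<bullet> h t) has_real_derivative (f t \<bullet> h' + f' \<bullet> h t)) (at t)"
    if "(f has_vector_derivative f') (at t)" "(h has_vector_derivative h') (at t)"
    for f h :: "real \<Rightarrow> 'a" and f' h' t
    unfolding has_field_derivative_def
    by (rule has_derivative_eq_rhs[OF has_derivative_inner[OF that[unfolded has_vector_derivative_def]]])
      (simp add: fun_eq_iff algebra_simps)
  have locconst: "D = 0" if "(f has_real_derivative D) (at t)" "t \<in> I" "\<And>u. u \<in> I \<Longrightarrow> f u = k" for f D t k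
  proof -
    have "(f has_real_derivative 0) (at t)"
      by (rule has_field_derivative_transform_within_open[OF DERIV_const[of k] I(1)]) (use that in auto)
    then show ?thesis using that(1) DERIV_unique by blast
  qed
  have yv: "y t \<bullet> \<gamma>' t = 0" if t: "t \<in> I" for t
  proof -
    have "y t \<bullet> \<gamma>' t + \<gamma>' t \<bullet> y t = 0"
      by (rule locconst[OF dinner[OF dy[OF t] dy[OF t]] t yy])
    then show ?thesis by (simp add: inner_commute)
  qed
  have acc: "\<exists>b. \<gamma>'' t = b *\<^sub>R y t" if t: "t \<in> I" for t
    using G(5)[OF t] g[OF G(1)[OF t]] unfolding y_def by (metis scaleR_scaleR)
  have va: "\<gamma>' t \<bullet> \<gamma>'' t = 0" if t: "t \<in> I" for t
    using acc[OF t] yv[OF t] by (auto simp: inner_commute)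
  obtain t0 where t0: "t0 \<in> I" using I(3) by blast
  have "((\<lambda>t. \<gamma>' t \<bullet> \<gamma>' t) has_real_derivative 0) (at t within I)" if t: "t \<in> I" for t
    using dinner[OF G(3)[OF t] G(3)[OF t]] va[OF t] by (simp add: inner_commute has_field_derivative_at_within)
  then obtain k where "\<And>t. t \<in> I \<Longrightarrow> \<gamma>' t \<bullet> \<gamma>' t = k"
    using has_field_derivative_zero_constant[OF conv] by metis
  then have speed: "\<gamma>' t \<bullet> \<gamma>' t = \<gamma>' t0 \<bullet> \<gamma>' t0" if "t \<in> I" for t using that t0 by metis
  define \<alpha> where "\<alpha> = (\<gamma>' t0 \<bullet> \<gamma>' t0) / r\<^sup>2"
  have \<alpha>: "\<alpha> > 0" using G(4)[OF t0] r by (simp add: \<alpha>_def)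
  have acc': "\<gamma>'' t = - \<alpha> *\<^sub>R y t" if t: "t \<in> I" for t
  proof -
    obtain b where b: "\<gamma>'' t = b *\<^sub>R y t" using acc[OF t] by blast
    \<comment> \<open>Differentiating the orthogonality of position and velocity determines the
      radial acceleration from the constant speed.\<close>
    have "y t \<bullet> \<gamma>'' t + \<gamma>' t \<bullet> \<gamma>' t = 0"
      by (rule locconst[OF dinner[OF dy[OF t] G(3)[OF t]] t yv])
    then have "b * r\<^sup>2 = - (\<gamma>' t0 \<bullet> \<gamma>' t0)" using yy[OF t] speed[OF t] by (simp add: b)
    then have "b = - \<alpha>" using r by (simp add: \<alpha>_def field_simps)
    then show ?thesis by (simp add: b)
  qed
  \<comment> \<open>A vector orthogonal to both initial position and initial velocity gives zero
    energy. As \<alpha> is positive, the coordinate of \<open>y\<close> along it stays zero.\<close>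
  have flat: "y t \<bullet> e = 0" if e: "y t0 \<bullet> e = 0" "\<gamma>' t0 \<bullet> e = 0" and t: "t \<in> I" for e t
  proof -
    define E where "E t = (\<gamma>' t \<bullet> e)\<^sup>2 + \<alpha> * (y t \<bullet> e)\<^sup>2" for t
    have "(E has_real_derivative 0) (at t within I)" if t: "t \<in> I" for t
    proof -
      have 1: "((\<lambda>t. \<gamma>' t \<bullet> e) has_real_derivative - \<alpha> * (y t \<bullet> e)) (at t)"
        using dinner[OF G(3)[OF t] has_vector_derivative_const[of e]] by (simp add: acc'[OF t])
      have 2: "((\<lambda>t. y t \<bullet> e) has_real_derivative \<gamma>' t \<bullet> e) (at t)"
        using dinner[OF dy[OF t] has_vector_derivative_const[of e]] by simp
      have "(E has_real_derivative 0) (at t)" unfolding E_def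
        by (rule derivative_eq_intros 1 2 refl)+ (simp add: algebra_simps)
      then show ?thesis by (rule has_field_derivative_at_within)
    qed
    then obtain k where "\<And>t. t \<in> I \<Longrightarrow> E t = k"
      using has_field_derivative_zero_constant[OF conv] by metis
    then have "E t = E t0" using t t0 by metis
    then have "(\<gamma>' t \<bullet> e)\<^sup>2 + \<alpha> * (y t \<bullet> e)\<^sup>2 = 0" using e by (simp add: E_def)
    then have "\<alpha> * (y t \<bullet> e)\<^sup>2 = 0"
      using \<alpha> by (simp add: add_nonneg_eq_0_iff)
    then show ?thesis using \<alpha> by simp
  qed
  define u w where "u = y t0 /\<^sub>R norm (y t0)" and "w = \<gamma>' t0 /\<^sub>R norm (\<gamma>' t0)"
  have nz: "y t0 \<noteq> 0" "\<gamma>' t0 \<noteq> 0" using yy[OF t0] r G(4)[OF t0] by auto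
  have on: "norm u = 1" "norm w = 1" "u \<bullet> w = 0" using nz yv[OF t0] by (auto simp: u_def w_def)
  have "\<gamma> t \<in> range (plane_chart C u w)" if t: "t \<in> I" for t
  proof -
    define e where "e = y t - (y t \<bullet> u) *\<^sub>R u - (y t \<bullet> w) *\<^sub>R w"
    have uw: "u \<bullet> u = 1" "w \<bullet> w = 1" "w \<bullet> u = 0" using on by (auto simp: norm_eq_1 inner_commute)
    have eu: "u \<bullet> e = 0" "w \<bullet> e = 0"
      using on uw by (auto simp: e_def inner_diff_right inner_commute[of _ "y t"])
    then have "y t0 \<bullet> e = 0" "\<gamma>' t0 \<bullet> e = 0" using nz by (auto simp: u_def w_def)
    then have "y t \<bullet> e = 0" using flat t by blast
    then have "e \<bullet> e = 0" using eu by (subst (1) e_def) (simp add: inner_diff_left)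
    then have "e = 0" by simp
    moreover have "y t = e + ((y t \<bullet> u) *\<^sub>R u + (y t \<bullet> w) *\<^sub>R w)" by (simp add: e_def)
    ultimately have "y t = (y t \<bullet> u) *\<^sub>R u + (y t \<bullet> w) *\<^sub>R w" by simp
    then have "\<gamma> t = plane_chart C u w (y t \<bullet> u, y t \<bullet> w)"
      by (simp add: plane_chart_def y_def algebra_simps)
    then show ?thesis by blast
  qed
  then show thesis using that on by (auto simp: orthonormal2_def)
qed

lemma plane_chart_sphere:
  assumes "orthonormal2 u w"
  shows "plane_chart C u w -` sphere C r = sphere 0 r"
proof -
  have uw: "u \<bullet> u = 1" "w \<bullet> w = 1" "u \<bullet> w = 0" "w \<bullet> u = 0"
    using assms by (auto simp: orthonormal2_def norm_eq_1 inner_commute)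
  have "dist C (plane_chart C u w z) = norm z" for z
  proof -
    have "plane_chart C u w z - C = fst z *\<^sub>R u + snd z *\<^sub>R w" by (simp add: plane_chart_def)
    then have "dist C (plane_chart C u w z) = norm (fst z *\<^sub>R u + snd z *\<^sub>R w)"
      by (metis dist_commute dist_norm)
    also have "\<dots> = norm z"
      unfolding norm_eq using uw by (simp add: inner_add_left inner_add_right inner_prod_def)
    finally show ?thesis .
  qed
  then show ?thesis by auto
qed

theorem theorem1p2:
  fixes F :: "'a::euclidean_space \<Rightarrow> real" and \<delta> :: real
  assumes "DIM('a) > 3"
    and "gutkin_table F \<delta>"
  shows "(\<not> (\<exists>n::nat. odd n \<and> n > 3 \<and> tan (real n * \<delta>) = real n * tan \<delta>) \<longrightarrow>
            (\<exists>c r. r > 0 \<and> surf F = sphere c r))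
       \<and> ((\<exists>n::nat. odd n \<and> n > 3 \<and> tan (real n * \<delta>) = real n * tan \<delta>) \<longrightarrow>
            constant_width (body F) \<and>
            (\<forall>I \<gamma>. geodesic F I \<gamma> \<longrightarrow>
               (\<exists>t\<in>I. principal_direction F (\<gamma> t) (vector_derivative \<gamma> (at t))) \<longrightarrow>
               (\<exists>a u w. orthonormal2 u w \<and>
                  (\<forall>t\<in>I. \<gamma> t \<in> range (plane_chart a u w)) \<and>
                  (\<exists>G :: real \<times> real \<Rightarrow> real. gutkin_table G \<delta> \<and>
                     surf G = plane_chart a u w -` surf F))))"
proof -
  interpret gutkin F \<delta>
    using assms by unfold_locales (auto simp: gutkin_table_def)
  obtain C r where r: "r > 0" and S: "surf F = sphere C r" and N: "\<And>x. x \<in> surf F \<Longrightarrow> N x = (x - C) /\<^sub>R r"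
    by (rule round_sphere) (rule that)
  have g: "\<exists>k. grad F x = k *\<^sub>R (x - C)" if x: "x \<in> surf F" for x
    using grad_eq[OF x] N[OF x] by (intro exI[of _ "norm (grad F x) / r"]) (simp add: divide_inverse)
  have "constant_width (body F)"
    using body_eq_cball[OF S r] constant_width_cball[OF r] by simp
  \<comment> \<open>Each plane is taken through the centre \<open>C\<close>, so the section is a
    great circle; in the orthonormal chart it is the circle of radius \<open>r\<close> about the
    origin, cut out by \<open>x \<bullet> x - r\<^sup>2\<close>.\<close>
  moreover have "\<exists>a u w. orthonormal2 u w \<and> (\<forall>t\<in>I. \<gamma> t \<in> range (plane_chart a u w)) \<and>
      (\<exists>G :: real \<times> real \<Rightarrow> real. gutkin_table G \<delta> \<and> surf G = plane_chart a u w -` surf F)"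
    if geo: "geodesic F I \<gamma>" for I \<gamma>
  proof -
    obtain u w where uw: "orthonormal2 u w" "\<And>t. t \<in> I \<Longrightarrow> \<gamma> t \<in> range (plane_chart C u w)"
      using sphere_geodesic_planar[OF geo S r g] by blast
    have "DIM(real \<times> real) \<ge> 2" by simp
    from round_sphere_gutkin_table[OF r delta this]
    have "gutkin_table (\<lambda>x::real \<times> real. x \<bullet> x - r\<^sup>2) \<delta>"
      "surf (\<lambda>x::real \<times> real. x \<bullet> x - r\<^sup>2) = plane_chart C u w -` surf F"
      using plane_chart_sphere[OF uw(1), of C r] S by simp_all
    then show ?thesis using uw by blast
  qed
  ultimately show ?thesis using r S by blast
qed

end
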